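(* Let $f:\mathbb{T}\to[0,1]$ be a Borel function with $\sigma:=\int_{\mathbb{T}} f\,d\mathfrak{m}\in(0,1)$, and let $(\xi_n)_{n\in\mathbb{Z}}$ be the $\{0,1\}$-valued random field of the determinantal point process on $\mathbb{Z}$ induced by the kernel $K_f(n,m)=\widehat{f}(n-m)$. Assume that $f$ is not an indicator function. Then for any $p\in[2,\infty)$ there exists $C_f(p)>0$ such that for every complex sequence $a=(a_n)_{n\in\mathbb{Z}}\in\ell^2(\mathbb{Z})$, $$\left\|\sum_n a_n(\xi_n-\sigma)\right\|_2\le\left\|\sum_n a_n(\xi_n-\sigma)\right\|_p\le C_f(p)\left\|\sum_n a_n(\xi_n-\sigma)\right\|_2.$$ Here we may take $$C_f(p)=\frac{2\sqrt{2}\,\Gamma\left(\frac p2+1\right)^{1/p}}{\sqrt{\int_{\mathbb{T}} f(1-f)\,d\mathfrak{m}}}.$$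
   Context: $\mathbb{T}=\mathbb{R}/\mathbb{Z}$ with normalized Lebesgue measure $\mathfrak{m}$; $\widehat{f}(n)=\int_{\mathbb{T}} f(t)e^{-2\pi i n t}\,d\mathfrak{m}(t)$. The (stationary) determinantal point process induced by $K_f$ is the random subset $\mathfrak{X}=\mathfrak{X}(\omega)$ of $\mathbb{Z}$, defined on a probability space $(\Omega,\mathcal{A},\mathbb{P})$, whose indicator random variables $\xi_n(\omega)=1$ if $n\in\mathfrak{X}(\omega)$ and $\xi_n(\omega)=0$ otherwise satisfy, for all distinct $n_1,\dots,n_k\in\mathbb{Z}$, $\mathbb{E}(\xi_{n_1}\cdots\xi_{n_k})=\det(\widehat{f}(n_i-n_j))_{1\le i,j\le k}$. Such a process exists and its law is uniquely determined by $f$. $\|\cdot\|_p$ is the norm of $L^p(\Omega,\mathbb{P})$; for $a\in\ell^2(\mathbb{Z})$ the series $\sum_n a_n(\xi_n-\sigma)$ converges in $L^2(\Omega,\mathbb{P})$ and denotes its $L^2$-limit. "$f$ is an indicator function" means that $f$ coincides $\mathfrak{m}$-almost everywhere with the indicator function of a Borel subset of $\mathbb{T}$. $\Gamma$ is the Gamma function. *)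

theory Defs
  imports "HOL-Probability.Probability" "Jordan_Normal_Form.Determinant"
begin

text \<open>The torus \<open>\<real>/\<int>\<close> is identified with its fundamental domain \<open>[0,1)\<close>. Under the
  canonical bijection the Borel sets correspond to the Borel subsets of \<open>[0,1)\<close> and the normalized
  Lebesgue measure to the restriction of Lebesgue measure, so functions on the torus are given
  by real functions of which only the values on \<open>[0,1)\<close> matter.\<close>

definition torus :: "real measure" where
  "torus = restrict_space lborel {0..<1}"

definition fourier_coeff :: "(real \<Rightarrow> real) \<Rightarrow> int \<Rightarrow> complex" where
  "fourier_coeff f n =
     (\<integral>t. complex_of_real (f t) * exp (- 2 * complex_of_real pi * \<i> * of_int n * complex_of_real t) \<partial>torus)"

definition ae_indicator :: "(real \<Rightarrow> real) \<Rightarrow> bool" where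
  "ae_indicator f \<longleftrightarrow> (\<exists>B\<in>sets torus. AE t in torus. f t = indicator B t)"

definition occupation :: "('w \<Rightarrow> int set) \<Rightarrow> int \<Rightarrow> 'w \<Rightarrow> real" where
  "occupation X n \<omega> = indicator (X \<omega>) n"

text \<open>The distinct points \<open>n\<^sub>1, \<dots>, n\<^sub>k\<close> are given as a list. The matrix and its determinant are those
  of \<open>Jordan_Normal_Form\<close>, since the size \<open>k\<close> varies.\<close>

definition determinantal_process :: "'w measure \<Rightarrow> (real \<Rightarrow> real) \<Rightarrow> ('w \<Rightarrow> int set) \<Rightarrow> bool" where
  "determinantal_process M f X \<longleftrightarrow>
     (\<forall>n. occupation X n \<in> borel_measurable M) \<and>
     (\<forall>ns. distinct ns \<longrightarrow>
        complex_of_real (\<integral>\<omega>. (\<Prod>n\<in>set ns. occupation X n \<omega>) \<partial>M) =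
        Determinant.det (Matrix.mat (length ns) (length ns)
          (\<lambda>(i, j). fourier_coeff f (ns ! i - ns ! j))))"

text \<open>The norm takes the value \<open>\<infinity>\<close> exactly outside of \<open>L\<^sup>p\<close>; it is meant for \<open>0 < p < \<infinity>\<close> and
  measurable \<open>g\<close>.\<close>

definition Lp_norm :: "'w measure \<Rightarrow> real \<Rightarrow> ('w \<Rightarrow> complex) \<Rightarrow> ennreal" where
  "Lp_norm M p g =
     (let I = (\<integral>\<^sup>+\<omega>. ennreal (norm (g \<omega>) powr p) \<partial>M)
      in if I = \<infinity> then \<infinity> else ennreal (enn2real I powr (1 / p)))"

text \<open>\<open>S\<close> is (a version of) the sum in \<open>L\<^sup>2\<close> of the family \<open>Y\<close>; as for \<open>has_sum\<close>, convergence is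
  along the finite sets of indices.\<close>

definition has_L2_sum :: "'w measure \<Rightarrow> ('i \<Rightarrow> 'w \<Rightarrow> complex) \<Rightarrow> ('w \<Rightarrow> complex) \<Rightarrow> bool" where
  "has_L2_sum M Y S \<longleftrightarrow>
     S \<in> borel_measurable M \<and> Lp_norm M 2 S < \<infinity> \<and>
     ((\<lambda>F. Lp_norm M 2 (\<lambda>\<omega>. S \<omega> - (\<Sum>n\<in>F. Y n \<omega>))) \<longlongrightarrow> 0) (finite_subsets_at_top UNIV)"

definition khinchine_const :: "(real \<Rightarrow> real) \<Rightarrow> real \<Rightarrow> real" where
  "khinchine_const f p =
     2 * sqrt 2 * Gamma (p / 2 + 1) powr (1 / p) / sqrt (\<integral>t. f t * (1 - f t) \<partial>torus)"

end

theory Submission imports Defs begin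

text \<open>The finite sections \<open>K\<close> of the kernel satisfy \<open>0 \<le> K \<le> I\<close>. Hadamard's inequality applied to
  \<open>K\<close> and to \<open>I - K\<close> (the kernel of the complementary process) bounds the mixed moments of the
  \<open>\<xi>\<^sub>n\<close> and of the \<open>1 - \<xi>\<^sub>n\<close> by those of independent variables. Hence a finite sum
  \<open>\<Sum> b\<^sub>n (\<xi>\<^sub>n - \<sigma>)\<close> with \<open>b\<^sub>n \<ge> 0\<close> is subgaussian by Hoeffding's lemma, with variance proxy
  \<open>\<parallel>b\<parallel>\<^sup>2 / 4\<close>, and its \<open>p\<close>-th moment is at most a multiple of \<open>\<Gamma> (p/2 + 1) \<parallel>b\<parallel>\<^sup>p\<close>. Complex
  coefficients are split into four nonnegative parts. In the other direction the variance of
  \<open>\<Sum> a\<^sub>n (\<xi>\<^sub>n - \<sigma>)\<close> is at least \<open>\<parallel>a\<parallel>\<^sup>2 \<integral> f (1 - f)\<close>, since the Toeplitz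
  matrix with entries \<open>\<bar>fourier_coeff f (n - m)\<bar>\<^sup>2\<close> has a symbol bounded by \<open>\<integral> f\<^sup>2\<close>. Both bounds pass to \<open>L\<^sup>2\<close>-limits by Fatou's lemma and continuity.\<close>

section \<open>Determinants of positive semidefinite kernels\<close>

text \<open>The obstacle is dependence: exponential moments of the sum do not factor. Domination by
  independent variables is available only for expectations of multilinear polynomials with
  nonnegative coefficients. On 0/1 variables \<open>exp (b * x)\<close> coincides with
  \<open>1 + (exp b - 1) * x\<close>, which is of this kind as soon as \<open>b \<ge> 0\<close>.
  This sign restriction is the reason for using both kernels and for splitting the coefficients. The
  constant \<open>2 * sqrt 2\<close> collects three losses: a power mean over four parts costs
  \<open>4 powr (p - 1)\<close>, the two signs in the exponential bound cost 2, and the optimised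
  exponential parameter contributes \<open>2 powr (- (p / 2))\<close>. Their product is
  \<open>2 powr (3 / 2 * p - 1)\<close>. The Gamma value enters through a weak Stirling bound. The
  denominator compares the norm of \<open>a\<close> with the norm of the sum; it is positive because
  \<open>f\<close> takes values strictly between 0 and 1 on a set of positive measure. The upper
  bound at \<open>p = 2\<close> has a second use: it is the Cauchy criterion from which the infinite
  sum is constructed.\<close>

lemma quadratic_form_Suc:
  fixes A :: "nat \<Rightarrow> nat \<Rightarrow> complex"
  shows "(\<Sum>i<Suc n. \<Sum>j<Suc n. cnj (c i) * A i j * c j) =
    (\<Sum>i<n. \<Sum>j<n. cnj (c i) * A i j * c j) + (\<Sum>i<n. cnj (c i) * A i n) * c n
      + cnj (c n) * (\<Sum>j<n. A n j * c j) + cnj (c n) * A n n * c n"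
  by (simp add: sum.distrib sum_distrib_left sum_distrib_right algebra_simps)

lemma psd_diag_nonneg:
  fixes A :: "nat \<Rightarrow> nat \<Rightarrow> complex"
  assumes psd: "\<And>c. 0 \<le> Re (\<Sum>i<n. \<Sum>j<n. cnj (c i) * A i j * c j)" and "k < n"
  shows "0 \<le> Re (A k k)"
proof -
  have "(\<Sum>i<n. \<Sum>j<n. cnj (if i = k then 1 else 0) * A i j * (if j = k then 1 else 0)) = A k k"
    using \<open>k < n\<close> by (simp add: if_distrib [of cnj] if_distrib [of "\<lambda>x. x * _"]
        if_distrib [of "(*) _"] cong: if_cong)
  with psd[of "\<lambda>i. if i = k then 1 else 0"] show ?thesis by simp
qed

lemma psd_zero_diag_imp_zero_column:
  fixes A :: "nat \<Rightarrow> nat \<Rightarrow> complex"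
  assumes herm: "\<And>i j. A j i = cnj (A i j)"
    and psd: "\<And>c. 0 \<le> Re (\<Sum>i<Suc n. \<Sum>j<Suc n. cnj (c i) * A i j * c j)"
    and "A n n = 0" and "k < n"
  shows "A k n = 0"
proof (rule ccontr)
  assume "A k n \<noteq> 0"
  define d where "d = Re (A k k)"
  have d: "d \<ge> 0" using psd_diag_nonneg[OF psd, of k] \<open>k < n\<close> by (simp add: d_def)
  have Akk: "A k k = of_real d"
    using herm[of k k] by (simp add: d_def complex_eq_iff)
  \<comment> \<open>The form at the test vector below is quadratic in \<open>e\<close> with negative
    linear part; \<open>e\<close> is so small that \<open>e * d \<le> 1\<close> and the linear part
    wins.\<close>
  define e where "e = 1 / (d + 1)"
  define v where "v = A k n"
  define c where "c = (\<lambda>i. if i = n then 1 else if i = k then - of_real e * v else 0)"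
  have 1: "(\<Sum>i<n. \<Sum>j<n. cnj (c i) * A i j * c j)
      = (\<Sum>i<n. if i = k then (\<Sum>j<n. if j = k then cnj (- of_real e * v) * A k k * (- of_real e * v) else 0) else 0)"
    (is "?l = ?r")
  proof -
    have "(\<Sum>j<n. cnj (c i) * A i j * c j) = (if i = k then (\<Sum>j<n. if j = k then cnj (- of_real e * v) * A k k * (- of_real e * v) else 0) else 0)"
      if "i < n" for i
    proof (cases "i = k")
      case True
      have "cnj (c i) * A i j * c j = (if j = k then cnj (- of_real e * v) * A k k * (- of_real e * v) else 0)"
        if "j < n" for j using that \<open>k < n\<close> True by (auto simp: c_def)
      then show ?thesis using True by simp
    next
      case False
      then show ?thesis using that by (simp add: c_def)
    qed
    then show ?thesis by simp
  qed
  have 2: "(\<Sum>i<n. cnj (c i) * A i n) = (\<Sum>i<n. if i = k then cnj (- of_real e * v) * v else 0)"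
    by (intro sum.cong) (auto simp: c_def v_def)
  have 3: "(\<Sum>j<n. A n j * c j) = (\<Sum>j<n. if j = k then cnj v * (- of_real e * v) else 0)"
    by (intro sum.cong) (auto simp: c_def v_def herm[of n])
  have vv: "cnj v * v = of_real ((norm v)\<^sup>2)" 
    by (simp add: complex_norm_square mult.commute del: of_real_power)
  have "(\<Sum>i<Suc n. \<Sum>j<Suc n. cnj (c i) * A i j * c j)
      = of_real (e * e * d) * (cnj v * v) - 2 * of_real e * (cnj v * v)"
    unfolding quadratic_form_Suc 1 2 3 using \<open>k < n\<close> \<open>A n n = 0\<close>
    by (simp add: c_def Akk algebra_simps)
  also have "\<dots> = of_real ((norm v)\<^sup>2 * e * (e * d - 2))"
    unfolding vv by (simp add: algebra_simps)
  finally have "0 \<le> (norm v)\<^sup>2 * e * (e * d - 2)" using psd[of c] by simp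
  moreover have "e * d \<le> 1" "e > 0" using d by (auto simp: e_def field_simps)
  ultimately have "(norm v)\<^sup>2 * e \<le> 0"
    by (smt (verit) mult_less_0_iff zero_le_mult_iff zero_le_power2)
  with \<open>e > 0\<close> \<open>A k n \<noteq> 0\<close> show False by (simp add: v_def mult_le_0_iff)
qed

lemma psd_schur_complement:
  fixes A :: "nat \<Rightarrow> nat \<Rightarrow> complex"
  assumes herm: "\<And>i j. A j i = cnj (A i j)"
    and psd: "\<And>c. 0 \<le> Re (\<Sum>i<Suc n. \<Sum>j<Suc n. cnj (c i) * A i j * c j)"
    and nz: "A n n \<noteq> 0"
  shows "0 \<le> Re (\<Sum>i<n. \<Sum>j<n. cnj (c i) * (A i j - A i n * A n j / A n n) * c j)"
proof -
  define v where "v = (\<Sum>j<n. A n j * c j)"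
  have v': "(\<Sum>i<n. cnj (c i) * A i n) = cnj v"
    unfolding v_def by (simp add: herm[of n] mult.commute)
  have real: "cnj (A n n) = A n n" using herm[of n n] by simp
  \<comment> \<open>The last coordinate completes the square: it minimises the full form, and what
    remains is the form of the Schur complement.\<close>
  define c' where "c' = c(n := - v / A n n)"
  have "(\<Sum>i<Suc n. \<Sum>j<Suc n. cnj (c' i) * A i j * c' j) =
     (\<Sum>i<n. \<Sum>j<n. cnj (c i) * A i j * c j) + cnj v * (- v / A n n)
     + (- cnj v / A n n) * v + (- cnj v / A n n) * A n n * (- v / A n n)"
    unfolding quadratic_form_Suc by (simp add: c'_def v' v_def[symmetric] real)
  also have "\<dots> = (\<Sum>i<n. \<Sum>j<n. cnj (c i) * A i j * c j) - cnj v * v / A n n"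
    using nz by (simp add: field_simps)
  also have "cnj v * v / A n n = (\<Sum>i<n. \<Sum>j<n. cnj (c i) * (A i n * A n j / A n n) * c j)"
    unfolding v'[symmetric] unfolding v_def
    by (simp add: sum_distrib_left sum_distrib_right sum_divide_distrib mult_ac)
  also have "(\<Sum>i<n. \<Sum>j<n. cnj (c i) * A i j * c j) - \<dots>
      = (\<Sum>i<n. \<Sum>j<n. cnj (c i) * (A i j - A i n * A n j / A n n) * c j)"
    by (simp add: sum_subtractf[symmetric] algebra_simps)
  finally show ?thesis using psd[of c'] by simp
qed

lemma det_schur_complement:
  fixes A :: "nat \<Rightarrow> nat \<Rightarrow> complex"
  assumes nz: "A n n \<noteq> 0"
  shows "Determinant.det (Matrix.mat (Suc n) (Suc n) (\<lambda>(i,j). A i j)) =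
    A n n * Determinant.det (Matrix.mat n n (\<lambda>(i,j). A i j - A i n * A n j / A n n))"
proof -
  let ?S = "Matrix.mat n n (\<lambda>(i,j). A i j - A i n * A n j / A n n)"
  \<comment> \<open>Block elimination with pivot \<open>A n n\<close>, written as a factorisation:
    \<open>?R\<close> is the matrix with its last column cleared above the pivot, and the
    unitriangular \<open>?L\<close> undoes the clearing.\<close>
  let ?L = "four_block_mat (1\<^sub>m n) (Matrix.mat n 1 (\<lambda>(i,j). A i n / A n n)) (0\<^sub>m 1 n) (1\<^sub>m 1)"
  let ?R = "four_block_mat ?S (0\<^sub>m n 1) (Matrix.mat 1 n (\<lambda>(i,j). A n j)) (Matrix.mat 1 1 (\<lambda>_. A n n))"
  have "?L * ?R = four_block_mat (1\<^sub>m n * ?S + Matrix.mat n 1 (\<lambda>(i,j). A i n / A n n) * Matrix.mat 1 n (\<lambda>(i,j). A n j))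
      (1\<^sub>m n * 0\<^sub>m n 1 + Matrix.mat n 1 (\<lambda>(i,j). A i n / A n n) * Matrix.mat 1 1 (\<lambda>_. A n n))
      (0\<^sub>m 1 n * ?S + 1\<^sub>m 1 * Matrix.mat 1 n (\<lambda>(i,j). A n j))
      (0\<^sub>m 1 n * 0\<^sub>m n 1 + 1\<^sub>m 1 * Matrix.mat 1 1 (\<lambda>_. A n n))"
    by (rule mult_four_block_mat) auto
  also have "\<dots> = Matrix.mat (Suc n) (Suc n) (\<lambda>(i,j). A i j)"
    using nz by (intro eq_matI) (auto simp: scalar_prod_def less_Suc_eq)
  finally have LR: "Matrix.mat (Suc n) (Suc n) (\<lambda>(i,j). A i j) = ?L * ?R" ..
  have L: "Determinant.det ?L = 1"
    by (subst det_four_block_mat_lower_left_zero[where n = n and m = 1]) auto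
  have "Determinant.det ?R = Determinant.det ?S * Determinant.det (Matrix.mat 1 1 (\<lambda>_. A n n))"
    by (rule det_four_block_mat_upper_right_zero) auto
  also have "Determinant.det (Matrix.mat 1 1 (\<lambda>_. A n n)) = A n n"
    by (simp add: det_single)
  finally have R: "Determinant.det ?R = Determinant.det ?S * A n n" .
  have "Determinant.det (?L * ?R) = Determinant.det ?L * Determinant.det ?R"
    by (rule det_mult[of _ "n + 1"], (rule four_block_carrier_mat; simp)+)
  then show ?thesis unfolding LR L R by (simp only: mult_1 mult.commute)
qed

text \<open>Eliminating the last index factors out the pivot and leaves a Schur complement that is
  again positive semidefinite and whose diagonal entries have not increased, so the induction
  hypothesis applies. A vanishing pivot forces a vanishing column, hence determinant 0.\<close>

lemma hadamard_inequality_psd: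
  fixes A :: "nat \<Rightarrow> nat \<Rightarrow> complex"
  assumes herm: "\<And>i j. A j i = cnj (A i j)"
    and psd: "\<And>c. 0 \<le> Re (\<Sum>i<n. \<Sum>j<n. cnj (c i) * A i j * c j)"
  shows "Re (Determinant.det (Matrix.mat n n (\<lambda>(i,j). A i j))) \<le> (\<Prod>i<n. Re (A i i))"
  using assms
proof (induction n arbitrary: A)
  case 0
  show ?case by (simp add: det_dim_zero)
next
  case (Suc n)
  note herm = Suc.prems(1) and psd = Suc.prems(2)
  have nonneg: "Re (A i i) \<ge> 0" if "i < Suc n" for i
    using psd_diag_nonneg[OF psd that] .
  define d where "d = Re (A n n)"
  have Ann: "A n n = of_real d"
    using herm[of n n] by (simp add: complex_eq_iff d_def)
  show ?case
  proof (cases "A n n = 0")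
    case True
    have "A i n = 0" if "i < Suc n" for i
    proof (cases "i = n")
      case False
      then have "i < n" using that by simp
      show ?thesis by (rule psd_zero_diag_imp_zero_column[OF herm psd True \<open>i < n\<close>])
    qed (simp add: True)
    then have "Determinant.det (Matrix.mat (Suc n) (Suc n) (\<lambda>(i,j). A i j)) = 0"
      by (subst laplace_expansion_column[of _ "Suc n" n]) (auto intro!: sum.neutral)
    moreover have "0 \<le> (\<Prod>i<Suc n. Re (A i i))"
      by (rule prod_nonneg) (simp add: nonneg)
    ultimately show ?thesis by simp
  next
    case False
    define S where "S = (\<lambda>i j. A i j - A i n * A n j / A n n)"
    have hermS: "S j i = cnj (S i j)" for i j
      unfolding S_def herm[of i j] herm[of i n] herm[of n j] by (simp add: Ann mult.commute)
    have psdS: "0 \<le> Re (\<Sum>i<n. \<Sum>j<n. cnj (c i) * S i j * c j)" for c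
      unfolding S_def by (rule psd_schur_complement[OF herm psd False])
    have le: "Re (S i i) \<le> Re (A i i)" if "i < n" for i
    proof -
      have "A i n * A n i = of_real ((norm (A i n))\<^sup>2)"
        unfolding herm[of i n] complex_norm_square by simp
      then have "A i n * A n i / A n n = of_real ((norm (A i n))\<^sup>2 / d)"
        unfolding Ann by simp
      then show ?thesis using nonneg[of n] by (simp add: S_def d_def)
    qed
    have nonnegS: "0 \<le> Re (S i i)" if "i < n" for i
      by (rule psd_diag_nonneg[OF psdS that])
    have "Re (Determinant.det (Matrix.mat (Suc n) (Suc n) (\<lambda>(i,j). A i j)))
        = Re (A n n) * Re (Determinant.det (Matrix.mat n n (\<lambda>(i,j). S i j)))"
    proof -
      have *: "Determinant.det (Matrix.mat (Suc n) (Suc n) (\<lambda>(i,j). A i j))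
          = A n n * Determinant.det (Matrix.mat n n (\<lambda>(i,j). S i j))"
        unfolding S_def by (rule det_schur_complement[of A, OF False])
      have "Im (A n n) = 0" by (simp add: Ann)
      then show ?thesis by (simp only: * times_complex.sel mult_zero_left diff_zero)
    qed
    also have "\<dots> \<le> Re (A n n) * (\<Prod>i<n. Re (S i i))"
      by (rule mult_left_mono[OF Suc.IH[of S, OF hermS psdS] nonneg[OF lessI]])
    also have "\<dots> \<le> Re (A n n) * (\<Prod>i<n. Re (A i i))"
      by (intro mult_left_mono prod_mono nonneg) (simp_all add: le nonnegS)
    finally show ?thesis by (simp add: mult.commute)
  qed
qed

text \<open>The Leibniz formula over the permutations of a finite set: a principal minor that needs
  no enumeration of \<open>T\<close>, so that minors can be summed over subsets.\<close>

definition minor_det :: "('i \<Rightarrow> 'i \<Rightarrow> 'a) \<Rightarrow> 'i set \<Rightarrow> 'a :: comm_ring_1" where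
  "minor_det K T = (\<Sum>\<pi> | \<pi> permutes T. of_int (sign \<pi>) * (\<Prod>i\<in>T. K i (\<pi> i)))"

text \<open>Conjugation with the enumeration \<open>ns\<close> is a sign-preserving bijection
  between the permutations of the positions and those of the points.\<close>

lemma det_eq_minor_det:
  fixes K :: "'i \<Rightarrow> 'i \<Rightarrow> 'a :: comm_ring_1"
  assumes "distinct ns"
  shows "Determinant.det (Matrix.mat (length ns) (length ns) (\<lambda>(i, j). K (ns ! i) (ns ! j)))
    = minor_det K (set ns)"
proof -
  define A where "A = {0..<length ns}"
  define f where "f = (!) ns"
  have inj: "inj_on f A"
    using assms by (auto simp: inj_on_def f_def A_def nth_eq_iff_index_eq)
  have fA: "f ` A = set ns"
    by (auto simp: f_def A_def set_conv_nth)
  have bij: "bij_betw f A (set ns)" using inj fA by (simp add: bij_betw_def)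
  have "Determinant.det (Matrix.mat (length ns) (length ns) (\<lambda>(i, j). K (ns ! i) (ns ! j)))
      = (\<Sum>p | p permutes A. of_int (sign p) * (\<Prod>i\<in>A. K (f i) (f (p i))))"
    unfolding A_def by (subst det_def'[of _ "length ns"])
      (auto simp: f_def intro!: sum.cong prod.cong dest: permutes_in_image)
  also have "\<dots> = (\<Sum>p | p permutes A. of_int (sign (map_permutation A f p)) *
      (\<Prod>i\<in>set ns. K i (map_permutation A f p i)))"
  proof (intro sum.cong refl)
    fix p assume "p \<in> {p. p permutes A}"
    then have p: "p permutes A" by simp
    have "sign (map_permutation A f p) = sign p"
      by (rule sign_map_permutation[OF inj p]) (simp add: A_def)
    moreover have "(\<Prod>i\<in>set ns. K i (map_permutation A f p i)) = (\<Prod>i\<in>A. K (f i) (f (p i)))"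
      unfolding fA[symmetric] prod.reindex[OF inj]
      by (auto intro!: prod.cong simp: map_permutation_apply[OF inj])
    ultimately show "of_int (sign p) * (\<Prod>i\<in>A. K (f i) (f (p i))) =
        of_int (sign (map_permutation A f p)) * (\<Prod>i\<in>set ns. K i (map_permutation A f p i))"
      by simp
  qed
  also have "\<dots> = minor_det K (set ns)"
  proof -
    have "bij_betw (map_permutation A f) {p. p permutes A} {p. p permutes set ns}"
    proof (rule bij_betw_byWitness[where f' = "map_permutation (set ns) (inv_into A f)"])
      have "bij_betw (inv_into A f) (set ns) A" by (rule bij_betw_inv_into[OF bij])
      then show "map_permutation (set ns) (inv_into A f) ` {p. p permutes set ns} \<subseteq> {p. p permutes A}"
        by (auto intro: map_permutation_permutes)
      show "map_permutation A f ` {p. p permutes A} \<subseteq> {p. p permutes set ns}"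
        using bij by (auto intro: map_permutation_permutes)
      show "\<forall>p\<in>{p. p permutes A}. map_permutation (set ns) (inv_into A f) (map_permutation A f p) = p"
      proof safe
        fix p assume p: "p permutes A"
        have "map_permutation (set ns) (inv_into A f) (map_permutation A f p)
            = map_permutation A (inv_into A f \<circ> f) p"
          using bij inj fA by (intro map_permutation_compose) (auto intro: inj_on_inv_into)
        also have "\<dots> = map_permutation A id p"
          using inj p by (intro map_permutation_cong) (auto intro: comp_inj_on inj_on_inv_into)
        finally show "map_permutation (set ns) (inv_into A f) (map_permutation A f p) = p"
          using p by simp
      qed
      show "\<forall>q\<in>{p. p permutes set ns}. map_permutation A f (map_permutation (set ns) (inv_into A f) q) = q"
      proof safe
        fix q assume q: "q permutes set ns"
        have "map_permutation A f (map_permutation (set ns) (inv_into A f) q)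
            = map_permutation (set ns) (f \<circ> inv_into A f) q"
          using bij inj fA by (intro map_permutation_compose) (auto intro: bij_betw_inv_into)
        also have "\<dots> = map_permutation (set ns) id q"
          using q fA by (intro map_permutation_cong) (auto simp: f_inv_into_f inj_on_def)
        finally show "map_permutation A f (map_permutation (set ns) (inv_into A f) q) = q"
          using q by simp
      qed
    qed
    then show ?thesis
      unfolding minor_det_def by (rule sum.reindex_bij_betw)
  qed
  finally show ?thesis .
qed

text \<open>Expanding the product of the factors
  \<open>of_bool (i = \<pi> i) - K i (\<pi> i)\<close> selects a subset \<open>S\<close> on which
  \<open>K\<close> is taken. Outside \<open>S\<close> the permutation has to be the identity, which
  means that it permutes \<open>S\<close>.\<close>

lemma minor_det_id_minus:
  fixes K :: "'i \<Rightarrow> 'i \<Rightarrow> 'a :: comm_ring_1"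
  assumes "finite T"
  shows "minor_det (\<lambda>i j. of_bool (i = j) - K i j) T = (\<Sum>S\<in>Pow T. (-1) ^ card S * minor_det K S)"
proof -
  have "minor_det (\<lambda>i j. of_bool (i = j) - K i j) T =
      (\<Sum>\<pi> | \<pi> permutes T. \<Sum>S\<in>Pow T. of_int (sign \<pi>) *
        ((-1) ^ card S * (\<Prod>i\<in>S. K i (\<pi> i)) * (\<Prod>i\<in>T-S. of_bool (i = \<pi> i))))"
    unfolding minor_det_def by (simp add: prod_diff_conv_sum[OF assms] sum_distrib_left)
  also have "\<dots> = (\<Sum>S\<in>Pow T. \<Sum>\<pi> | \<pi> permutes T. of_int (sign \<pi>) *
        ((-1) ^ card S * (\<Prod>i\<in>S. K i (\<pi> i)) * (\<Prod>i\<in>T-S. of_bool (i = \<pi> i))))"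
    by (rule sum.swap)
  also have "\<dots> = (\<Sum>S\<in>Pow T. (-1) ^ card S * minor_det K S)"
  proof (intro sum.cong refl)
    fix S assume "S \<in> Pow T"
    then have S: "S \<subseteq> T" "finite S" using assms finite_subset by auto
    have "(\<Prod>i\<in>T-S. of_bool (i = \<pi> i)) = (of_bool (\<pi> permutes S) :: 'a)" if "\<pi> permutes T" for \<pi>
    proof (cases "\<pi> permutes S")
      case True
      then have "i = \<pi> i" if "i \<in> T - S" for i using that permutes_not_in[OF True] by simp
      then show ?thesis using True by simp
    next
      case False
      then have "\<exists>i\<in>T-S. i \<noteq> \<pi> i"
        using that permutes_superset[OF that, of S] by metis
      then show ?thesis using False assms by (auto intro!: prod_zero)
    qed
    then have "(\<Sum>\<pi> | \<pi> permutes T. of_int (sign \<pi>) *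
        ((-1) ^ card S * (\<Prod>i\<in>S. K i (\<pi> i)) * (\<Prod>i\<in>T-S. of_bool (i = \<pi> i))))
      = (\<Sum>\<pi> | \<pi> permutes T. if \<pi> permutes S then (-1) ^ card S * (of_int (sign \<pi>) * (\<Prod>i\<in>S. K i (\<pi> i))) else 0)"
      by (intro sum.cong) auto
    also have "\<dots> = (\<Sum>\<pi> | \<pi> permutes S. (-1) ^ card S * (of_int (sign \<pi>) * (\<Prod>i\<in>S. K i (\<pi> i))))"
      using S permutes_subset[OF _ S(1)] finite_permutations[OF assms]
      by (subst sum.inter_filter[symmetric]) (auto intro!: sum.cong)
    finally show "(\<Sum>\<pi> | \<pi> permutes T. of_int (sign \<pi>) *
        ((-1) ^ card S * (\<Prod>i\<in>S. K i (\<pi> i)) * (\<Prod>i\<in>T-S. of_bool (i = \<pi> i))))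
      = (-1) ^ card S * minor_det K S"
      by (simp add: minor_det_def sum_distrib_left)
  qed
  finally show ?thesis .
qed

lemma minor_det_le_prod_diag:
  fixes K :: "'i \<Rightarrow> 'i \<Rightarrow> complex"
  assumes "finite T" and herm: "\<And>i j. K j i = cnj (K i j)"
    and psd: "\<And>c. 0 \<le> Re (\<Sum>i\<in>T. \<Sum>j\<in>T. cnj (c i) * K i j * c j)"
  shows "Re (minor_det K T) \<le> (\<Prod>i\<in>T. Re (K i i))"
proof -
  obtain ns where ns: "set ns = T" "distinct ns"
    using finite_distinct_list[OF \<open>finite T\<close>] by blast
  let ?n = "length ns"
  have inj: "inj_on ((!) ns) {..<?n}"
    using ns by (auto simp: inj_on_def nth_eq_iff_index_eq)
  have im: "T = (!) ns ` {..<?n}"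
    using ns by (auto simp: set_conv_nth)
  have "Re (minor_det K T) = Re (Determinant.det (Matrix.mat ?n ?n (\<lambda>(i, j). K (ns ! i) (ns ! j))))"
    using det_eq_minor_det[OF ns(2), of K] ns(1) by simp
  also have "\<dots> \<le> (\<Prod>i<?n. Re (K (ns ! i) (ns ! i)))"
  proof (rule hadamard_inequality_psd)
    fix c :: "nat \<Rightarrow> complex"
    define d where "d = (\<lambda>x. c (inv_into {..<?n} ((!) ns) x))"
    have d: "d (ns ! i) = c i" if "i < ?n" for i
      unfolding d_def using inv_into_f_f[OF inj] that by simp
    have "(\<Sum>i\<in>T. \<Sum>j\<in>T. cnj (d i) * K i j * d j)
        = (\<Sum>i<?n. \<Sum>j<?n. cnj (c i) * K (ns ! i) (ns ! j) * c j)"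
      unfolding im by (simp add: sum.reindex[OF inj] d)
    then show "0 \<le> Re (\<Sum>i<?n. \<Sum>j<?n. cnj (c i) * K (ns ! i) (ns ! j) * c j)"
      using psd[of d] by simp
  qed (rule herm)
  also have "\<dots> = (\<Prod>i\<in>T. Re (K i i))"
    unfolding im by (simp add: prod.reindex[OF inj])
  finally show ?thesis .
qed

section \<open>Fourier coefficients\<close>

lemma has_bochner_integral_imp_nonneg:
  assumes "has_bochner_integral M f x" and "\<And>t. t \<in> space M \<Longrightarrow> 0 \<le> f t"
  shows "0 \<le> (x :: real)"
  using Bochner_Integration.integral_nonneg[of M f] assms by (auto simp: has_bochner_integral_iff)

definition torus_char :: "int \<Rightarrow> real \<Rightarrow> complex" where
  "torus_char n t = exp (- 2 * complex_of_real pi * \<i> * of_int n * complex_of_real t)"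

lemma torus_char_eq_cis: "torus_char n t = cis (- 2 * pi * n * t)"
  by (simp add: torus_char_def cis_conv_exp algebra_simps)

lemma torus_char_0 [simp]: "torus_char 0 t = 1"
  by (simp add: torus_char_def)

lemma norm_torus_char [simp]: "norm (torus_char n t) = 1"
  by (simp add: torus_char_eq_cis)

lemma cnj_torus_char: "cnj (torus_char n t) = torus_char (- n) t"
  by (simp add: torus_char_eq_cis cis_cnj)

lemma torus_char_diff: "torus_char (n - m) t = torus_char n t * cnj (torus_char m t)"
  by (simp add: torus_char_eq_cis cis_cnj cis_mult algebra_simps)

lemma space_torus [simp]: "space torus = {0..<1}"
  by (simp add: torus_def space_restrict_space)

lemma prob_space_torus: "prob_space torus"
  by (rule prob_spaceI) (simp add: torus_def emeasure_restrict_space space_restrict_space)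

interpretation torus: prob_space torus
  by (rule prob_space_torus)

lemma torus_char_measurable [measurable]: "torus_char n \<in> borel_measurable torus"
  unfolding torus_def torus_char_def
  by (intro measurable_restrict_space1) simp

lemma integral_torus_char:
  "(\<integral>t. torus_char n t \<partial>torus) = of_bool (n = 0)"
proof (cases "n = 0")
  case True
  then show ?thesis using torus.prob_space by simp
next
  case False
  let ?F = "\<lambda>t. torus_char n t / (- 2 * complex_of_real pi * \<i> * of_int n)"
  have "(\<integral>t. torus_char n t \<partial>torus) = (\<integral>t. indicator {0..<1} t *\<^sub>R torus_char n t \<partial>lborel)"
    unfolding torus_def by (subst integral_restrict_space) auto
  \<comment> \<open>The intervals differ by a null set; the fundamental theorem of calculus is
    applied on the closed one.\<close>
  also have "\<dots> = (\<integral>t. indicator {0..1} t *\<^sub>R torus_char n t \<partial>lborel)"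
  proof (rule integral_cong_AE)
    show "AE t in lborel. indicator {0..<1} t *\<^sub>R torus_char n t = indicator {0..1} t *\<^sub>R torus_char n t"
      using AE_lborel_singleton[of 1] by eventually_elim (simp split: split_indicator)
  qed (simp_all add: torus_char_def)
  also have "\<dots> = ?F 1 - ?F 0"
  proof (rule integral_FTC_Icc)
    show "continuous_on {0..1} (torus_char n)"
      unfolding torus_char_def by (intro continuous_intros)
    fix x :: real
    show "(?F has_vector_derivative torus_char n x) (at x within {0..1})"
      unfolding torus_char_def using False
      by (auto intro!: derivative_eq_intros has_vector_derivative_real_field)
  qed simp
  also have "torus_char n 1 = torus_char n 0"
  proof -
    have "torus_char n 1 = cis (2 * pi * of_int (- n))" by (simp add: torus_char_eq_cis)
    also have "\<dots> = 1" by (rule cis_multiple_2pi) simp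
    finally show ?thesis by (simp add: torus_char_def)
  qed
  finally show ?thesis using False by simp
qed

lemma fourier_coeff_eq: "fourier_coeff g n = (\<integral>t. complex_of_real (g t) * torus_char n t \<partial>torus)"
  unfolding fourier_coeff_def torus_char_def ..

lemma has_integral_fourier_coeff:
  assumes [measurable]: "g \<in> borel_measurable torus"
    and bdd: "\<And>t. t \<in> space torus \<Longrightarrow> \<bar>g t\<bar> \<le> 1"
  shows "has_bochner_integral torus (\<lambda>t. complex_of_real (g t) * torus_char n t) (fourier_coeff g n)"
proof -
  have "integrable torus (\<lambda>t. complex_of_real (g t) * torus_char n t)"
    by (rule torus.integrable_const_bound[of _ 1])
      (use bdd in \<open>auto simp: norm_mult\<close>)
  then show ?thesis
    by (simp add: has_bochner_integral_iff fourier_coeff_eq)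
qed

lemma has_integral_torus_char:
  "has_bochner_integral torus (torus_char n) (of_bool (n = 0))"
proof -
  have "integrable torus (torus_char n)"
    by (rule torus.integrable_const_bound[of _ 1]) auto
  then show ?thesis by (simp add: has_bochner_integral_iff integral_torus_char)
qed

lemma fourier_coeff_minus: "fourier_coeff g (- n) = cnj (fourier_coeff g n)"
  unfolding fourier_coeff_eq Bochner_Integration.integral_cnj[symmetric]
  by (simp add: cnj_torus_char del: Bochner_Integration.integral_cnj)

lemma fourier_coeff_0: "fourier_coeff g 0 = of_real (\<integral>t. g t \<partial>torus)"
  by (simp add: fourier_coeff_def)

lemma fourier_coeff_one_minus:
  assumes "g \<in> borel_measurable torus" and "\<And>t. t \<in> space torus \<Longrightarrow> \<bar>g t\<bar> \<le> 1"
  shows "fourier_coeff (\<lambda>t. 1 - g t) n = of_bool (n = 0) - fourier_coeff g n"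
proof -
  have "has_bochner_integral torus (\<lambda>t. torus_char n t - complex_of_real (g t) * torus_char n t)
      (of_bool (n = 0) - fourier_coeff g n)"
    by (intro has_bochner_integral_diff has_integral_torus_char has_integral_fourier_coeff assms)
  then have "(\<integral>t. torus_char n t - complex_of_real (g t) * torus_char n t \<partial>torus)
      = of_bool (n = 0) - fourier_coeff g n"
    by (simp only: has_bochner_integral_iff)
  then show ?thesis
    by (simp add: fourier_coeff_eq left_diff_distrib)
qed

text \<open>The form is the integral of \<open>g\<close> against the squared modulus of the
  trigonometric polynomial \<open>P\<close>. Taken for \<open>f\<close> and for
  \<open>1 - f\<close>, this supplies both cases in which Hadamard's inequality is used.\<close>

lemma fourier_coeff_psd:
  assumes [measurable]: "g \<in> borel_measurable torus" and g: "\<And>t. t \<in> space torus \<Longrightarrow> g t \<in> {0..1}"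
  shows "0 \<le> Re (\<Sum>i\<in>T. \<Sum>j\<in>T. cnj (c i) * fourier_coeff g (i - j) * c j)"
proof -
  define P where "P = (\<lambda>t. \<Sum>i\<in>T. cnj (c i) * torus_char i t)"
  have "has_bochner_integral torus
      (\<lambda>t. \<Sum>i\<in>T. \<Sum>j\<in>T. cnj (c i) * (complex_of_real (g t) * torus_char (i - j) t) * c j)
      (\<Sum>i\<in>T. \<Sum>j\<in>T. cnj (c i) * fourier_coeff g (i - j) * c j)"
    by (intro has_bochner_integral_sum has_bochner_integral_mult_left has_bochner_integral_mult_right
        has_integral_fourier_coeff) (use g in auto)
  also have "(\<lambda>t. \<Sum>i\<in>T. \<Sum>j\<in>T. cnj (c i) * (complex_of_real (g t) * torus_char (i - j) t) * c j)
      = (\<lambda>t. complex_of_real (g t * (norm (P t))\<^sup>2))"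
  proof
    fix t
    have "cnj (P t) = (\<Sum>j\<in>T. c j * cnj (torus_char j t))"
      by (simp add: P_def)
    then have "complex_of_real ((norm (P t))\<^sup>2)
        = (\<Sum>i\<in>T. cnj (c i) * torus_char i t) * (\<Sum>j\<in>T. c j * cnj (torus_char j t))"
      unfolding complex_norm_square by (simp only: P_def)
    then show "(\<Sum>i\<in>T. \<Sum>j\<in>T. cnj (c i) * (complex_of_real (g t) * torus_char (i - j) t) * c j)
        = complex_of_real (g t * (norm (P t))\<^sup>2)"
      unfolding of_real_mult sum_product
      by (simp only: torus_char_diff sum_distrib_left mult_ac)
  qed
  finally have hb: "has_bochner_integral torus (\<lambda>t. complex_of_real (g t * (norm (P t))\<^sup>2))
      (\<Sum>i\<in>T. \<Sum>j\<in>T. cnj (c i) * fourier_coeff g (i - j) * c j)" .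
  have "has_bochner_integral torus (\<lambda>t. g t * (norm (P t))\<^sup>2)
      (Re (\<Sum>i\<in>T. \<Sum>j\<in>T. cnj (c i) * fourier_coeff g (i - j) * c j))"
    using has_bochner_integral_Re[OF hb] by simp
  then show ?thesis
    by (rule has_bochner_integral_imp_nonneg) (use g in auto)
qed

text \<open>With \<open>P\<close> the trigonometric polynomial with coefficients \<open>a\<close>, expand
  \<open>0 \<le> \<integral>\<integral> (f s - f t)\<^sup>2 \<bar>P (s - t)\<bar>\<^sup>2 dt ds\<close>.\<close>

lemma sum_fourier_coeff_squares_le:
  assumes f [measurable]: "f \<in> borel_measurable torus" and f01: "\<And>t. t \<in> space torus \<Longrightarrow> f t \<in> {0..1}"
    and "finite T"
  shows "Re (\<Sum>n\<in>T. \<Sum>m\<in>T. a n * cnj (a m) * (fourier_coeff f (n - m) * fourier_coeff f (m - n)))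
    \<le> (\<integral>t. (f t)\<^sup>2 \<partial>torus) * (\<Sum>n\<in>T. (norm (a n))\<^sup>2)"
proof -
  define F where "F = (\<lambda>t. (f t)\<^sup>2)"
  have F_meas [measurable]: "F \<in> borel_measurable torus" unfolding F_def by measurable
  have F: "\<bar>F t\<bar> \<le> 1" if "t \<in> space torus" for t
    using f01[OF that] by (auto simp: F_def power_le_one)
  have f1: "\<bar>f t\<bar> \<le> 1" if "t \<in> space torus" for t using f01[OF that] by auto
  let ?c = "torus_char" and ?h = "fourier_coeff"
  \<comment> \<open>Each summand separates into factors in \<open>s\<close> and factors in
    \<open>t\<close>, so that integrating first over \<open>t\<close> (to \<open>H\<close>) and then
    over \<open>s\<close> (to \<open>I\<close>) produces Fourier coefficients.\<close>
  define G where "G = (\<lambda>s t. \<Sum>n\<in>T. \<Sum>m\<in>T. a n * cnj (a m) * ?c (n - m) s *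
      (of_real (F s) * ?c (m - n) t - 2 * of_real (f s) * (of_real (f t) * ?c (m - n) t) + of_real (F t) * ?c (m - n) t))"
  define H where "H = (\<lambda>s. \<Sum>n\<in>T. \<Sum>m\<in>T. a n * cnj (a m) * ?c (n - m) s *
      (of_real (F s) * of_bool (m - n = 0) - 2 * of_real (f s) * ?h f (m - n) + ?h F (m - n)))"
  define I where "I = (\<Sum>n\<in>T. \<Sum>m\<in>T. a n * cnj (a m) *
      (?h F (n - m) * of_bool (m - n = 0) - 2 * (?h f (n - m) * ?h f (m - n)) + of_bool (n - m = 0) * ?h F (m - n)))"
  have G: "G s t = of_real ((f s - f t)\<^sup>2 * (norm (\<Sum>n\<in>T. a n * (?c n s * cnj (?c n t))))\<^sup>2)" for s t
  proof -
    have "G s t = of_real ((f s - f t)\<^sup>2) *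
        (\<Sum>n\<in>T. \<Sum>m\<in>T. a n * cnj (a m) * (?c (n - m) s * ?c (m - n) t))"
      unfolding G_def F_def sum_distrib_left
      by (intro sum.cong refl) (simp add: power2_eq_square algebra_simps)
    also have "(\<Sum>n\<in>T. \<Sum>m\<in>T. a n * cnj (a m) * (?c (n - m) s * ?c (m - n) t))
        = (\<Sum>n\<in>T. a n * (?c n s * cnj (?c n t))) * cnj (\<Sum>n\<in>T. a n * (?c n s * cnj (?c n t)))"
      by (simp add: torus_char_diff sum_product mult_ac)
    also have "\<dots> = of_real ((norm (\<Sum>n\<in>T. a n * (?c n s * cnj (?c n t))))\<^sup>2)"
      by (rule complex_norm_square[symmetric])
    finally show ?thesis by simp
  qed
  have GH: "has_bochner_integral torus (G s) (H s)" for s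
    unfolding G_def H_def
    by (intro has_bochner_integral_sum has_bochner_integral_mult_right has_bochner_integral_add
        has_bochner_integral_diff has_integral_fourier_coeff has_integral_torus_char f F_meas F f1)
  have H_nonneg: "0 \<le> Re (H s)" for s
  proof -
    have "has_bochner_integral torus (\<lambda>t. Re (G s t)) (Re (H s))"
      by (rule has_bochner_integral_Re[OF GH])
    then show ?thesis by (rule has_bochner_integral_imp_nonneg) (simp add: G)
  qed
  \<comment> \<open>Regrouped so that \<open>F s\<close> and \<open>f s\<close> stand next to the
    character in \<open>s\<close> with which they are integrated.\<close>
  have H: "H = (\<lambda>s. \<Sum>n\<in>T. \<Sum>m\<in>T. a n * cnj (a m) *
      ((of_real (F s) * ?c (n - m) s) * of_bool (m - n = 0)
        - 2 * ((of_real (f s) * ?c (n - m) s) * ?h f (m - n)) + ?c (n - m) s * ?h F (m - n)))"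
    unfolding H_def by (intro ext sum.cong refl) (simp add: algebra_simps)
  have "has_bochner_integral torus H I"
    unfolding I_def H
    by (intro has_bochner_integral_sum has_bochner_integral_mult_right has_bochner_integral_mult_left
        has_bochner_integral_add has_bochner_integral_diff has_integral_fourier_coeff
        has_integral_torus_char f F_meas F f1)
  then have "has_bochner_integral torus (\<lambda>s. Re (H s)) (Re I)"
    by (rule has_bochner_integral_Re)
  then have I_nonneg: "0 \<le> Re I"
    by (rule has_bochner_integral_imp_nonneg) (rule H_nonneg)
  define D where "D = (\<Sum>n\<in>T. \<Sum>m\<in>T. of_bool (n = m) * (2 * (a n * cnj (a n)) * ?h F 0))"
  define B where "B = (\<Sum>n\<in>T. \<Sum>m\<in>T. a n * cnj (a m) * (?h f (n - m) * ?h f (m - n)))"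
  \<comment> \<open>Orthogonality leaves the two squares only on the diagonal, where they contribute
    equally; the mixed product \<open>f s * f t\<close> gives \<open>B\<close>.\<close>
  have I: "I = D - 2 * B"
    unfolding I_def D_def B_def sum_distrib_left sum_subtractf[symmetric]
  proof (intro sum.cong refl)
    fix n m
    show "a n * cnj (a m) * (?h F (n - m) * of_bool (m - n = 0) - 2 * (?h f (n - m) * ?h f (m - n))
          + of_bool (n - m = 0) * ?h F (m - n))
      = of_bool (n = m) * (2 * (a n * cnj (a n)) * ?h F 0)
        - 2 * (a n * cnj (a m) * (?h f (n - m) * ?h f (m - n)))"
      by (cases "n = m") (simp_all add: right_diff_distrib distrib_left)
  qed
  have "(\<Sum>m\<in>T. of_bool (n = m) * (2 * (a n * cnj (a n)) * ?h F 0))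
      = of_real (2 * (\<integral>t. F t \<partial>torus) * (norm (a n))\<^sup>2)" if "n \<in> T" for n
  proof -
    have "(\<Sum>m\<in>T. of_bool (n = m) * (2 * (a n * cnj (a n)) * ?h F 0))
        = (\<Sum>m\<in>T. if n = m then 2 * (a n * cnj (a n)) * ?h F 0 else 0)"
      by (intro sum.cong) auto
    also have "\<dots> = 2 * (a n * cnj (a n)) * ?h F 0" using that \<open>finite T\<close> by simp
    finally show ?thesis
      by (simp only: fourier_coeff_0 complex_norm_square[symmetric]) simp
  qed
  then have D: "D = of_real (2 * (\<integral>t. F t \<partial>torus) * (\<Sum>n\<in>T. (norm (a n))\<^sup>2))"
    unfolding D_def by (simp add: sum_distrib_left)
  have "Re I = 2 * (\<integral>t. F t \<partial>torus) * (\<Sum>n\<in>T. (norm (a n))\<^sup>2) - 2 * Re B"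
    unfolding I D by simp
  with I_nonneg show ?thesis by (simp add: F_def B_def)
qed

section \<open>Exponential moments\<close>

text \<open>For \<open>p \<le> 1\<close> the left side is the exponential moment of a Bernoulli
  variable with mean \<open>p\<close>; this is Hoeffding's lemma in uncentred form.\<close>

lemma one_plus_exp_le:
  fixes h p :: real
  assumes "0 \<le> h" "0 \<le> p"
  shows "1 + p * (exp h - 1) \<le> exp (h * p + h\<^sup>2 / 8)"
proof -
  have pos: "0 < 1 + p * (exp h - 1)" using assms by (simp add: add_pos_nonneg)
  have "ln (1 + p * (exp h - 1)) \<le> h * p + h\<^sup>2 / 8"
    using Hoeffdings_lemma_aux[OF assms] by simp
  then show ?thesis using pos by (metis exp_le_cancel_iff exp_ln)
qed

lemma (in prob_space) integrable_prod_zero_one: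
  fixes Y :: "'i \<Rightarrow> 'a \<Rightarrow> real"
  assumes "\<And>n \<omega>. Y n \<omega> \<in> {0, 1}" and [measurable]: "\<And>n. Y n \<in> borel_measurable M"
  shows "integrable M (\<lambda>\<omega>. \<Prod>n\<in>S. Y n \<omega>)"
proof (rule integrable_const_bound[of _ 1])
  have "\<bar>\<Prod>n\<in>S. Y n \<omega>\<bar> \<le> 1" for \<omega>
    unfolding abs_prod
  proof (intro prod_le_1)
    fix n show "0 \<le> \<bar>Y n \<omega>\<bar> \<and> \<bar>Y n \<omega>\<bar> \<le> 1" using assms(1)[of n \<omega>] by auto
  qed
  then show "AE \<omega> in M. norm (\<Prod>n\<in>S. Y n \<omega>) \<le> 1" by simp
qed measurable

text \<open>Hoeffding's bound without independence: all coefficients of the expanded product are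
  nonnegative, so an upper bound on the mixed moments suffices.\<close>

lemma (in prob_space) exp_moment_le:
  fixes Y :: "'i \<Rightarrow> 'a \<Rightarrow> real" and b :: "'i \<Rightarrow> real"
  assumes "finite T" and Y [measurable]: "\<And>n. Y n \<in> borel_measurable M"
    and Y01: "\<And>n \<omega>. Y n \<omega> \<in> {0, 1}"
    and moments: "\<And>S. S \<subseteq> T \<Longrightarrow> expectation (\<lambda>\<omega>. \<Prod>n\<in>S. Y n \<omega>) \<le> q ^ card S"
    and "0 \<le> q" and b: "\<And>n. 0 \<le> b n"
  shows "expectation (\<lambda>\<omega>. exp (\<Sum>n\<in>T. b n * (Y n \<omega> - q))) \<le> exp ((\<Sum>n\<in>T. (b n)\<^sup>2) / 8)"
proof -
  have int: "integrable M (\<lambda>\<omega>. \<Prod>n\<in>S. Y n \<omega>)" for S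
    by (rule integrable_prod_zero_one[OF Y01 Y])
  have eq: "exp (\<Sum>n\<in>T. b n * (Y n \<omega> - q)) = exp (- (\<Sum>n\<in>T. b n * q)) *
      (\<Sum>S\<in>Pow T. (\<Prod>n\<in>S. exp (b n) - 1) * (\<Prod>n\<in>S. Y n \<omega>))" for \<omega>
  proof -
    have "exp (\<Sum>n\<in>T. b n * (Y n \<omega> - q)) = exp (- (\<Sum>n\<in>T. b n * q)) * (\<Prod>n\<in>T. exp (b n * Y n \<omega>))"
      using \<open>finite T\<close> by (simp add: exp_sum[symmetric] exp_add[symmetric] right_diff_distrib sum_subtractf)
    \<comment> \<open>On the values 0 and 1 the exponential agrees with an affine function, so the
      product becomes a multilinear polynomial.\<close>
    also have "(\<Prod>n\<in>T. exp (b n * Y n \<omega>)) = (\<Prod>n\<in>T. (exp (b n) - 1) * Y n \<omega> + 1)"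
    proof (rule prod.cong[OF refl])
      fix n
      from Y01[of n \<omega>] show "exp (b n * Y n \<omega>) = (exp (b n) - 1) * Y n \<omega> + 1" by auto
    qed
    also have "\<dots> = (\<Sum>S\<in>Pow T. (\<Prod>n\<in>S. exp (b n) - 1) * (\<Prod>n\<in>S. Y n \<omega>))"
      using \<open>finite T\<close> by (simp add: prod_add prod.distrib)
    finally show ?thesis .
  qed
  have "expectation (\<lambda>\<omega>. exp (\<Sum>n\<in>T. b n * (Y n \<omega> - q))) = exp (- (\<Sum>n\<in>T. b n * q)) *
      (\<Sum>S\<in>Pow T. (\<Prod>n\<in>S. exp (b n) - 1) * expectation (\<lambda>\<omega>. \<Prod>n\<in>S. Y n \<omega>))"
    unfolding eq by (simp add: int)
  also have "\<dots> \<le> exp (- (\<Sum>n\<in>T. b n * q)) * (\<Sum>S\<in>Pow T. (\<Prod>n\<in>S. exp (b n) - 1) * q ^ card S)"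
    using b moments by (intro mult_left_mono sum_mono prod_nonneg) auto
  \<comment> \<open>The sum over subsets folds back into a product, as for independent variables
    with mean \<open>q\<close>.\<close>
  also have "\<dots> = exp (- (\<Sum>n\<in>T. b n * q)) * (\<Prod>n\<in>T. (exp (b n) - 1) * q + 1)"
    using \<open>finite T\<close> by (simp add: prod_add prod.distrib)
  also have "\<dots> \<le> exp (- (\<Sum>n\<in>T. b n * q)) * (\<Prod>n\<in>T. exp (b n * q + (b n)\<^sup>2 / 8))"
    using one_plus_exp_le[OF b \<open>0 \<le> q\<close>] b \<open>0 \<le> q\<close>
    by (intro mult_left_mono prod_mono) (auto simp: add.commute mult.commute)
  also have "\<dots> = exp ((\<Sum>n\<in>T. (b n)\<^sup>2) / 8)"
    using \<open>finite T\<close>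
    by (simp add: exp_sum[symmetric] exp_add[symmetric] sum.distrib sum_divide_distrib)
  finally show ?thesis .
qed

section \<open>From exponential moments to absolute moments of order \<open>p\<close>\<close>

lemma Gamma_ge_powr_exp:
  fixes q :: real
  assumes "q > 0"
  shows "(q / exp 1) powr q \<le> Gamma (q + 1)"
proof -
  have "((\<lambda>t. exp (- t)) has_integral exp (- q)) {q..}"
    using has_integral_exp_minus_to_infinity[of 1 q] by simp
  then have "((\<lambda>t. q powr q * exp (- t)) has_integral q powr q * exp (- q)) {q..}"
    by (rule has_integral_mult_right)
  \<comment> \<open>The Gamma integral is cut off below \<open>q\<close>, since on the rest
    \<open>t powr q \<ge> q powr q\<close>. The resulting weak Stirling bound later absorbs the
    optimised exponential constant.\<close>
  then have 1: "((\<lambda>t. if t \<in> {q..} then q powr q * exp (- t) else 0) has_integral q powr q * exp (- q)) {0..}"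
    using assms by (subst has_integral_restrict) auto
  have 2: "((\<lambda>t. t powr q / exp t) has_integral Gamma (q + 1)) {0..}"
    using Gamma_integral_real[of "q + 1"] assms by simp
  have "q powr q * exp (- q) \<le> Gamma (q + 1)"
  proof (rule has_integral_le[OF 1 2])
    fix t :: real
    show "(if t \<in> {q..} then q powr q * exp (- t) else 0) \<le> t powr q / exp t"
      using assms by (auto simp: exp_minus divide_inverse intro!: mult_right_mono powr_mono2)
  qed
  moreover have "(q / exp 1) powr q = q powr q * exp (- q)"
    using assms by (simp add: powr_def ln_div right_diff_distrib exp_diff) (simp add: exp_minus divide_inverse)
  ultimately show ?thesis by simp
qed

text \<open>\<open>x powr p * exp (- l * x)\<close> is largest at \<open>x = p / l\<close>; the
  inequality is \<open>ln y \<le> y - 1\<close> at \<open>y = l * x / p\<close>.\<close>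

lemma powr_le_exp:
  fixes x l p :: real
  assumes "0 \<le> x" "0 < l" "0 < p"
  shows "x powr p \<le> (p / (exp 1 * l)) powr p * exp (l * x)"
proof (cases "x = 0")
  case False
  then have "x > 0" using assms by simp
  have "ln (l * x / p) \<le> l * x / p - 1"
    using \<open>x > 0\<close> assms by (intro ln_le_minus_one) simp
  then have "ln x \<le> l * x / p - 1 + ln (p / l)"
    using \<open>x > 0\<close> assms by (simp add: ln_mult ln_div)
  then have "p * ln x \<le> p * (l * x / p - 1 + ln (p / l))"
    using assms by (intro mult_left_mono) auto
  also have "\<dots> = l * x + p * ln (p / (exp 1 * l))"
    using assms by (simp add: ln_mult ln_div field_simps)
  finally have "exp (p * ln x) \<le> exp (l * x) * exp (p * ln (p / (exp 1 * l)))"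
    by (simp flip: exp_add)
  then show ?thesis using \<open>x > 0\<close> assms by (simp add: powr_def mult.commute)
qed simp

lemma (in prob_space) abs_moment_le_of_exp_moment:
  fixes Z :: "'a \<Rightarrow> real"
  assumes [measurable]: "Z \<in> borel_measurable M" and bdd: "\<And>\<omega>. \<bar>Z \<omega>\<bar> \<le> B"
    and exp_moment: "\<And>l. expectation (\<lambda>\<omega>. exp (l * Z \<omega>)) \<le> exp (l\<^sup>2 * A / 8)"
    and "0 < A" "0 < p"
  shows "expectation (\<lambda>\<omega>. \<bar>Z \<omega>\<bar> powr p) \<le> 2 * 2 powr (- (p / 2)) * Gamma (p / 2 + 1) * A powr (p / 2)"
proof -
  \<comment> \<open>This value minimises
    \<open>(p / (exp 1 * l)) powr p * exp (l\<^sup>2 * A / 8)\<close> over \<open>l > 0\<close>; the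
    exponential factor then becomes \<open>exp (p / 2)\<close>.\<close>
  define l where "l = sqrt (4 * p / A)"
  define C where "C = (p / (exp 1 * l)) powr p"
  have "l > 0" using assms by (simp add: l_def)
  have l2: "l\<^sup>2 = 4 * p / A" using assms by (simp add: l_def)
  \<comment> \<open>Types are inhabited, so an arbitrary sample point shows that the bound is
    nonnegative.\<close>
  have "B \<ge> 0" using bdd[of undefined] by linarith
  have int_exp: "integrable M (\<lambda>\<omega>. exp (r * Z \<omega>))" for r
  proof (rule integrable_const_bound[of _ "exp (\<bar>r\<bar> * B)"])
    have "r * Z \<omega> \<le> \<bar>r\<bar> * B" for \<omega>
      using mult_mono[OF order_refl bdd[of \<omega>], of "\<bar>r\<bar>"] abs_ge_self[of "r * Z \<omega>"]
      by (simp add: abs_mult)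
    then show "AE \<omega> in M. norm (exp (r * Z \<omega>)) \<le> exp (\<bar>r\<bar> * B)" by simp
  qed measurable
  have int_powr: "integrable M (\<lambda>\<omega>. \<bar>Z \<omega>\<bar> powr p)"
    using bdd \<open>0 < p\<close>
    by (intro integrable_const_bound[of _ "B powr p"]) (auto intro!: powr_mono2)
  have "expectation (\<lambda>\<omega>. \<bar>Z \<omega>\<bar> powr p) \<le> expectation (\<lambda>\<omega>. C * (exp (l * Z \<omega>) + exp ((- l) * Z \<omega>)))"
  proof (rule integral_mono[OF int_powr])
    show "integrable M (\<lambda>\<omega>. C * (exp (l * Z \<omega>) + exp ((- l) * Z \<omega>)))"
      by (intro integrable_mult_right Bochner_Integration.integrable_add int_exp)
    fix \<omega>
    have "\<bar>Z \<omega>\<bar> powr p \<le> C * exp (l * \<bar>Z \<omega>\<bar>)"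
      unfolding C_def by (rule powr_le_exp) (use \<open>l > 0\<close> \<open>0 < p\<close> in auto)
    \<comment> \<open>Removing the absolute value costs the sum over both signs, the origin of the
      leading factor 2.\<close>
    also have "\<dots> \<le> C * (exp (l * Z \<omega>) + exp ((- l) * Z \<omega>))"
      by (intro mult_left_mono) (auto simp: C_def abs_if)
    finally show "\<bar>Z \<omega>\<bar> powr p \<le> C * (exp (l * Z \<omega>) + exp ((- l) * Z \<omega>))" .
  qed
  also have "\<dots> = C * (expectation (\<lambda>\<omega>. exp (l * Z \<omega>)) + expectation (\<lambda>\<omega>. exp ((- l) * Z \<omega>)))"
    using int_exp[of l] int_exp[of "- l"] by simp
  also have "\<dots> \<le> C * (exp (l\<^sup>2 * A / 8) + exp ((- l)\<^sup>2 * A / 8))"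
    by (intro mult_left_mono add_mono exp_moment) (simp add: C_def)
  also have "\<dots> = 2 * (C * exp (p / 2))"
    using \<open>0 < A\<close> by (simp add: l2)
  \<comment> \<open>The powers of \<open>p\<close> collect into the expression that
    \<open>Gamma_ge_powr_exp\<close> bounds at \<open>q = p / 2\<close>.\<close>
  also have "C * exp (p / 2) = (2 powr (- (p / 2)) * A powr (p / 2)) * (p / 2 / exp 1) powr (p / 2)"
  proof -
    have X: "ln (p / (exp 1 * l)) = ln p - 1 - (2 * ln 2 + ln p - ln A) / 2"
      using assms \<open>l > 0\<close> ln_realpow[of 2 2] by (simp add: ln_div ln_mult l_def ln_sqrt)
    have Y: "ln (p / 2 / exp 1) = ln p - ln 2 - 1"
      using assms by (simp add: ln_div ln_mult)
    have e: "p * ln (p / (exp 1 * l)) + p / 2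
        = - (p / 2) * ln 2 + p / 2 * ln A + p / 2 * ln (p / 2 / exp 1)"
      unfolding X Y by (simp add: field_simps)
    have "C * exp (p / 2) = exp (p * ln (p / (exp 1 * l)) + p / 2)"
      using assms \<open>l > 0\<close> by (simp add: C_def powr_def exp_add)
    also have "\<dots> = (2 powr (- (p / 2)) * A powr (p / 2)) * (p / 2 / exp 1) powr (p / 2)"
      unfolding e using assms by (simp add: powr_def mult_exp_exp)
    finally show ?thesis .
  qed
  also have "2 * \<dots> \<le> 2 * ((2 powr (- (p / 2)) * A powr (p / 2)) * Gamma (p / 2 + 1))"
    using Gamma_ge_powr_exp[of "p / 2"] \<open>0 < p\<close> by (intro mult_left_mono) auto
  finally show ?thesis by (simp add: mult_ac)
qed

section \<open>Finite sums over the process\<close>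

locale stationary_dpp = prob_space M for M :: "'w measure" +
  fixes f :: "real \<Rightarrow> real" and X :: "'w \<Rightarrow> int set"
  assumes f_measurable: "f \<in> borel_measurable torus"
    and f01: "\<And>t. t \<in> space torus \<Longrightarrow> f t \<in> {0..1}"
    and dpp: "determinantal_process M f X"
begin

definition \<sigma> :: real where "\<sigma> = (\<integral>t. f t \<partial>torus)"

abbreviation \<xi> :: "int \<Rightarrow> 'w \<Rightarrow> real" where "\<xi> \<equiv> occupation X"

definition partial_sum :: "(int \<Rightarrow> complex) \<Rightarrow> int set \<Rightarrow> 'w \<Rightarrow> complex" where
  "partial_sum a T \<omega> = (\<Sum>n\<in>T. a n * of_real (\<xi> n \<omega> - \<sigma>))"

lemma \<xi>_measurable [measurable]: "\<xi> n \<in> borel_measurable M"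
  using dpp by (simp add: determinantal_process_def)

lemma \<xi>_cases: "\<xi> n \<omega> \<in> {0, 1}"
  by (simp add: occupation_def indicator_def)

lemma partial_sum_measurable [measurable]: "partial_sum a T \<in> borel_measurable M"
  unfolding partial_sum_def by measurable

lemma integrable_f: "integrable torus f"
  by (rule torus.integrable_const_bound[of _ 1]) (use f01 f_measurable in auto)

lemma \<sigma>_nonneg: "0 \<le> \<sigma>"
  unfolding \<sigma>_def by (rule Bochner_Integration.integral_nonneg) (use f01 in auto)

lemma \<sigma>_le_1: "\<sigma> \<le> 1"
  unfolding \<sigma>_def by (rule torus.integral_le_const[OF integrable_f AE_I2]) (use f01 in auto)

lemma expectation_prod_eq_minor_det:
  assumes "finite S"
  shows "complex_of_real (expectation (\<lambda>\<omega>. \<Prod>n\<in>S. \<xi> n \<omega>)) = minor_det (\<lambda>i j. fourier_coeff f (i - j)) S"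
proof -
  obtain ns where ns: "set ns = S" "distinct ns" using finite_distinct_list[OF assms] by blast
  have "complex_of_real (expectation (\<lambda>\<omega>. \<Prod>n\<in>set ns. \<xi> n \<omega>)) =
      Determinant.det (Matrix.mat (length ns) (length ns) (\<lambda>(i, j). fourier_coeff f (ns ! i - ns ! j)))"
    using dpp ns(2) unfolding determinantal_process_def by blast
  also have "\<dots> = minor_det (\<lambda>i j. fourier_coeff f (i - j)) (set ns)"
    by (rule det_eq_minor_det[OF ns(2)])
  finally show ?thesis unfolding ns(1) .
qed

lemma correlation_le:
  assumes "finite S"
  shows "expectation (\<lambda>\<omega>. \<Prod>n\<in>S. \<xi> n \<omega>) \<le> \<sigma> ^ card S"
proof -
  have "expectation (\<lambda>\<omega>. \<Prod>n\<in>S. \<xi> n \<omega>) = Re (minor_det (\<lambda>i j. fourier_coeff f (i - j)) S)"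
    by (simp flip: expectation_prod_eq_minor_det[OF assms])
  also have "\<dots> \<le> (\<Prod>i\<in>S. Re (fourier_coeff f (i - i)))"
    by (rule minor_det_le_prod_diag[OF assms _ fourier_coeff_psd[OF f_measurable f01]])
      (simp_all flip: fourier_coeff_minus)
  finally show ?thesis by (simp add: fourier_coeff_0 \<sigma>_def)
qed

text \<open>Inclusion-exclusion turns the vacancy probability into an alternating sum of minors of
  the kernel. By \<open>minor_det_id_minus\<close> this is a minor of the kernel belonging to
  \<open>1 - f\<close>, whose diagonal entries are \<open>1 - \<sigma>\<close>.\<close>

lemma vacancy_le:
  assumes "finite S"
  shows "expectation (\<lambda>\<omega>. \<Prod>n\<in>S. 1 - \<xi> n \<omega>) \<le> (1 - \<sigma>) ^ card S"
proof -
  let ?g = "\<lambda>t. 1 - f t"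
  have g: "?g \<in> borel_measurable torus" "\<And>t. t \<in> space torus \<Longrightarrow> ?g t \<in> {0..1}"
    using f_measurable f01 by auto
  have kernel: "(\<lambda>i j. fourier_coeff ?g (i - j)) = (\<lambda>i j. of_bool (i = j) - fourier_coeff f (i - j))"
    using f01 by (intro ext) (subst fourier_coeff_one_minus[OF f_measurable], auto)
  have "complex_of_real (expectation (\<lambda>\<omega>. \<Prod>n\<in>S. 1 - \<xi> n \<omega>))
      = complex_of_real (expectation (\<lambda>\<omega>. \<Sum>U\<in>Pow S. (-1) ^ card U * (\<Prod>n\<in>U. \<xi> n \<omega>)))"
    by (simp add: prod_diff_conv_sum[OF assms])
  also have "\<dots> = (\<Sum>U\<in>Pow S. (-1) ^ card U * complex_of_real (expectation (\<lambda>\<omega>. \<Prod>n\<in>U. \<xi> n \<omega>)))"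
    by (simp add: integrable_prod_zero_one[of \<xi>, OF \<xi>_cases])
  also have "\<dots> = minor_det (\<lambda>i j. fourier_coeff ?g (i - j)) S"
    unfolding kernel minor_det_id_minus[OF assms]
    by (intro sum.cong refl) (metis PowD assms expectation_prod_eq_minor_det finite_subset)
  finally have "expectation (\<lambda>\<omega>. \<Prod>n\<in>S. 1 - \<xi> n \<omega>) = Re (minor_det (\<lambda>i j. fourier_coeff ?g (i - j)) S)"
    by (metis Re_complex_of_real)
  also have "\<dots> \<le> (\<Prod>i\<in>S. Re (fourier_coeff ?g (i - i)))"
    by (rule minor_det_le_prod_diag[OF assms _ fourier_coeff_psd[OF g]])
      (simp_all flip: fourier_coeff_minus)
  finally show ?thesis
    using torus.prob_space by (simp add: fourier_coeff_0 \<sigma>_def integrable_f)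
qed

lemma expectation_\<xi>: "expectation (\<xi> n) = \<sigma>"
proof -
  have "complex_of_real (expectation (\<xi> n)) = minor_det (\<lambda>i j. fourier_coeff f (i - j)) {n}"
    using expectation_prod_eq_minor_det[of "{n}"] by simp
  also have "\<dots> = of_real \<sigma>"
    by (simp add: minor_det_def fourier_coeff_0 \<sigma>_def)
  finally show ?thesis by (simp only: of_real_eq_iff)
qed

lemma integrable_\<xi>: "integrable M (\<xi> n)"
  using integrable_prod_zero_one[of \<xi> "{n}"] \<xi>_cases by simp

text \<open>One formula serves both cases: off the diagonal it is the 2x2 minor, and for
  \<open>n = m\<close> idempotence of \<open>\<xi> n\<close> makes its second moment
  \<open>\<sigma>\<close>, while the product of the coefficients is
  \<open>\<sigma> * \<sigma>\<close>.\<close>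

lemma covariance:
  "complex_of_real (expectation (\<lambda>\<omega>. (\<xi> n \<omega> - \<sigma>) * (\<xi> m \<omega> - \<sigma>)))
    = of_bool (n = m) * of_real \<sigma> - fourier_coeff f (n - m) * fourier_coeff f (m - n)"
proof -
  have "integrable M (\<lambda>\<omega>. \<xi> n \<omega> * \<xi> m \<omega>)"
  proof (rule integrable_const_bound[of _ 1])
    have "\<bar>\<xi> n \<omega> * \<xi> m \<omega>\<bar> \<le> 1" for \<omega> using \<xi>_cases[of n \<omega>] \<xi>_cases[of m \<omega>] by auto
    then show "AE \<omega> in M. norm (\<xi> n \<omega> * \<xi> m \<omega>) \<le> 1" by simp
  qed measurable
  moreover have "(\<xi> n \<omega> - \<sigma>) * (\<xi> m \<omega> - \<sigma>) = \<xi> n \<omega> * \<xi> m \<omega> - \<sigma> * \<xi> n \<omega> - \<sigma> * \<xi> m \<omega> + \<sigma> * \<sigma>" for \<omega>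
    by (simp add: algebra_simps)
  ultimately have cov: "expectation (\<lambda>\<omega>. (\<xi> n \<omega> - \<sigma>) * (\<xi> m \<omega> - \<sigma>)) = expectation (\<lambda>\<omega>. \<xi> n \<omega> * \<xi> m \<omega>) - \<sigma> * \<sigma>"
    by (simp add: integrable_\<xi> expectation_\<xi> prob_space)
  show ?thesis
  proof (cases "n = m")
    case True
    have "(\<lambda>\<omega>. \<xi> n \<omega> * \<xi> m \<omega>) = \<xi> n"
      using \<xi>_cases[of n] True by fastforce
    then show ?thesis unfolding cov using True by (simp add: expectation_\<xi> fourier_coeff_0 flip: \<sigma>_def)
  next
    case False
    have perms: "{\<pi>. \<pi> permutes {n, m}} = {id, Transposition.transpose n m}"
      by (auto simp: permutes_doubleton_iff)
    have ne: "id \<noteq> Transposition.transpose n m"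
      using False by (metis id_apply transpose_apply_first)
    have "complex_of_real (expectation (\<lambda>\<omega>. \<xi> n \<omega> * \<xi> m \<omega>)) = minor_det (\<lambda>i j. fourier_coeff f (i - j)) {n, m}"
      using expectation_prod_eq_minor_det[of "{n, m}"] False by simp
    also have "\<dots> = of_real (\<sigma> * \<sigma>) - fourier_coeff f (n - m) * fourier_coeff f (m - n)"
      unfolding minor_det_def perms using False ne
      by (simp add: sign_swap_id fourier_coeff_0 flip: \<sigma>_def)
    finally show ?thesis using False by (simp add: cov)
  qed
qed

lemma expectation_partial_sum_ge:
  assumes "finite T"
  shows "(\<integral>t. f t * (1 - f t) \<partial>torus) * (\<Sum>n\<in>T. (norm (a n))\<^sup>2) \<le> expectation (\<lambda>\<omega>. (norm (partial_sum a T \<omega>))\<^sup>2)"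
proof -
  define B where "B = (\<Sum>n\<in>T. \<Sum>m\<in>T. a n * cnj (a m) * (fourier_coeff f (n - m) * fourier_coeff f (m - n)))"
  define A where "A = (\<Sum>n\<in>T. (norm (a n))\<^sup>2)"
  have int: "integrable M (\<lambda>\<omega>. (\<xi> n \<omega> - \<sigma>) * (\<xi> m \<omega> - \<sigma>))" for n m
  proof (rule integrable_const_bound[of _ 1])
    have "\<bar>\<xi> n \<omega> - \<sigma>\<bar> \<le> 1" for n \<omega> using \<xi>_cases[of n \<omega>] \<sigma>_nonneg \<sigma>_le_1 by auto
    then have "\<bar>(\<xi> n \<omega> - \<sigma>) * (\<xi> m \<omega> - \<sigma>)\<bar> \<le> 1" for \<omega>
      unfolding abs_mult by (intro mult_le_one) auto
    then show "AE \<omega> in M. norm ((\<xi> n \<omega> - \<sigma>) * (\<xi> m \<omega> - \<sigma>)) \<le> 1" by simp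
  qed measurable
  have "(\<lambda>\<omega>. complex_of_real ((norm (partial_sum a T \<omega>))\<^sup>2))
      = (\<lambda>\<omega>. \<Sum>n\<in>T. \<Sum>m\<in>T. a n * cnj (a m) * complex_of_real ((\<xi> n \<omega> - \<sigma>) * (\<xi> m \<omega> - \<sigma>)))"
  proof
    fix \<omega>
    have "cnj (partial_sum a T \<omega>) = (\<Sum>m\<in>T. cnj (a m) * of_real (\<xi> m \<omega> - \<sigma>))"
      by (simp add: partial_sum_def)
    then show "complex_of_real ((norm (partial_sum a T \<omega>))\<^sup>2)
      = (\<Sum>n\<in>T. \<Sum>m\<in>T. a n * cnj (a m) * complex_of_real ((\<xi> n \<omega> - \<sigma>) * (\<xi> m \<omega> - \<sigma>)))"
      unfolding complex_norm_square by (simp only: partial_sum_def sum_product of_real_mult mult_ac)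
  qed
  then have "complex_of_real (expectation (\<lambda>\<omega>. (norm (partial_sum a T \<omega>))\<^sup>2))
      = expectation (\<lambda>\<omega>. \<Sum>n\<in>T. \<Sum>m\<in>T. a n * cnj (a m) * complex_of_real ((\<xi> n \<omega> - \<sigma>) * (\<xi> m \<omega> - \<sigma>)))"
    unfolding integral_complex_of_real[symmetric] by simp
  also have "\<dots> = (\<Sum>n\<in>T. \<Sum>m\<in>T. a n * cnj (a m) *
      complex_of_real (expectation (\<lambda>\<omega>. (\<xi> n \<omega> - \<sigma>) * (\<xi> m \<omega> - \<sigma>))))"
    using int by (simp only: Bochner_Integration.integral_sum Bochner_Integration.integrable_sum
        integral_mult_right_zero integrable_mult_right complex_of_real_integrable_eq integral_complex_of_real)
  also have "\<dots> = (\<Sum>n\<in>T. \<Sum>m\<in>T. if n = m then of_real (\<sigma> * (norm (a n))\<^sup>2) else 0) - B"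
    unfolding covariance B_def sum_subtractf[symmetric]
  proof (intro sum.cong refl)
    fix n m
    have "complex_of_real (\<sigma> * (norm (a n))\<^sup>2) = of_real \<sigma> * (a n * cnj (a n))"
      unfolding of_real_mult complex_norm_square ..
    then show "a n * cnj (a m) * (of_bool (n = m) * of_real \<sigma> - fourier_coeff f (n - m) * fourier_coeff f (m - n))
      = (if n = m then complex_of_real (\<sigma> * (norm (a n))\<^sup>2) else 0) -
        a n * cnj (a m) * (fourier_coeff f (n - m) * fourier_coeff f (m - n))"
      by (cases "n = m") (simp_all only: right_diff_distrib if_True if_False of_bool_eq refl mult_1 mult_ac
          simp_thms mult_zero_left mult_zero_right)
  qed
  also have "(\<Sum>n\<in>T. \<Sum>m\<in>T. if n = m then of_real (\<sigma> * (norm (a n))\<^sup>2) else 0) = complex_of_real (\<sigma> * A)"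
    using assms by (simp add: A_def sum_distrib_left)
  finally have "expectation (\<lambda>\<omega>. (norm (partial_sum a T \<omega>))\<^sup>2) = Re (complex_of_real (\<sigma> * A) - B)"
    by (metis Re_complex_of_real)
  \<comment> \<open>The Toeplitz part takes away at most the integral of
    \<open>(f t)\<^sup>2\<close> times \<open>A\<close>; \<open>\<sigma>\<close> minus that integral
    is the integral of \<open>f t * (1 - f t)\<close>.\<close>
  moreover have "Re B \<le> (\<integral>t. (f t)\<^sup>2 \<partial>torus) * A"
    unfolding B_def A_def by (rule sum_fourier_coeff_squares_le[OF f_measurable f01 assms])
  moreover have "integrable torus (\<lambda>t. (f t)\<^sup>2)"
    by (rule torus.integrable_const_bound[of _ 1])
      (use f01 f_measurable in \<open>auto simp: power_le_one\<close>)
  then have "(\<integral>t. f t * (1 - f t) \<partial>torus) = \<sigma> - (\<integral>t. (f t)\<^sup>2 \<partial>torus)"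
    by (simp add: \<sigma>_def right_diff_distrib integrable_f flip: power2_eq_square)
  ultimately show ?thesis by (simp add: A_def left_diff_distrib)
qed

end

section \<open>Power inequalities and moments of finite sums\<close>

lemma powr_ge_tangent:
  fixes y p :: real
  assumes "0 \<le> y" "1 \<le> p"
  shows "1 + p * (y - 1) \<le> y powr p"
proof (cases "y = 0")
  case False
  have "((\<lambda>x. x powr p) has_real_derivative p * 1) (at 1 within {0<..})"
    by (auto intro!: derivative_eq_intros)
  then have "p * 1 * (y - 1) \<le> y powr p - 1 powr p"
    using powr_convex[OF \<open>1 \<le> p\<close>] assms False
    by (intro convex_on_imp_above_tangent[where A = "{0<..}"]) (auto simp: interior_open)
  then show ?thesis by simp
qed (use assms in simp)

text \<open>The power mean inequality: the tangent bound is taken at the arithmetic mean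
  \<open>m\<close>, where the linear terms cancel on summation.\<close>

lemma powr_sum_le:
  fixes x :: "'k \<Rightarrow> real"
  assumes "finite K" "K \<noteq> {}" and x: "\<And>k. k \<in> K \<Longrightarrow> 0 \<le> x k" and "1 \<le> p"
  shows "(\<Sum>k\<in>K. x k) powr p \<le> card K powr (p - 1) * (\<Sum>k\<in>K. x k powr p)"
proof (cases "(\<Sum>k\<in>K. x k) = 0")
  case True
  then show ?thesis using \<open>1 \<le> p\<close> by (simp add: sum_nonneg)
next
  case False
  define c where "c = real (card K)"
  have c: "c > 0" using assms by (simp add: c_def card_gt_0_iff)
  define m where "m = (\<Sum>k\<in>K. x k) / c"
  have "(\<Sum>k\<in>K. x k) > 0" using False sum_nonneg[of K x] x by (simp add: order_less_le)
  then have m: "m > 0" using c by (simp add: m_def)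
  have "m powr p * c = (\<Sum>k\<in>K. m powr p * (1 + p * (x k / m - 1)))"
  proof -
    have "(\<Sum>k\<in>K. x k / m) = (\<Sum>k\<in>K. x k) / m" by (simp add: sum_divide_distrib)
    also have "\<dots> = c" using False c by (simp add: m_def)
    finally have "(\<Sum>k\<in>K. x k / m) = c" .
    then have "(\<Sum>k\<in>K. 1 + p * (x k / m - 1)) = c"
      unfolding sum.distrib sum_distrib_left[symmetric] sum_subtractf by (simp add: c_def)
    then show ?thesis by (simp flip: sum_distrib_left)
  qed
  also have "\<dots> \<le> (\<Sum>k\<in>K. m powr p * (x k / m) powr p)"
    using x m \<open>1 \<le> p\<close> by (intro sum_mono mult_left_mono powr_ge_tangent) auto
  also have "\<dots> = (\<Sum>k\<in>K. x k powr p)"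
    using x m by (intro sum.cong refl) (simp flip: powr_mult)
  finally have "c powr (p - 1) * (m powr p * c) \<le> c powr (p - 1) * (\<Sum>k\<in>K. x k powr p)"
    by (intro mult_left_mono) auto
  also have "c powr (p - 1) * (m powr p * c) = (m * c) powr p"
    using c m by (simp add: powr_diff powr_mult)
  finally show ?thesis using c by (simp add: m_def c_def)
qed

text \<open>Write \<open>x powr p\<close> as \<open>x * x powr (p - 1)\<close> and bound the second
  factor by the same power of the whole sum. This later merges the four parts of the
  coefficients.\<close>

lemma sum_powr_le:
  fixes x :: "'k \<Rightarrow> real"
  assumes "finite K" and x: "\<And>k. k \<in> K \<Longrightarrow> 0 \<le> x k" and "1 \<le> p"
  shows "(\<Sum>k\<in>K. x k powr p) \<le> (\<Sum>k\<in>K. x k) powr p"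
proof -
  define s where "s = (\<Sum>k\<in>K. x k)"
  have le: "x k \<le> s" if "k \<in> K" for k
    unfolding s_def using assms that by (intro member_le_sum) auto
  have pow: "y powr p = y * y powr (p - 1)" if "0 \<le> y" for y :: real
    using that by (cases "y = 0") (simp_all add: powr_diff)
  have "s \<ge> 0" unfolding s_def using x by (rule sum_nonneg)
  have "(\<Sum>k\<in>K. x k powr p) \<le> (\<Sum>k\<in>K. x k * s powr (p - 1))"
  proof (rule sum_mono)
    fix k assume "k \<in> K"
    then show "x k powr p \<le> x k * s powr (p - 1)"
      using x le \<open>1 \<le> p\<close> unfolding pow[OF x[OF \<open>k \<in> K\<close>]] by (intro mult_left_mono powr_mono2) auto
  qed
  also have "\<dots> = s powr p"
    unfolding pow[OF \<open>s \<ge> 0\<close>] by (simp add: s_def sum_distrib_right)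
  finally show ?thesis by (simp add: s_def)
qed

context stationary_dpp
begin

lemma abs_moment_le_nonneg_coeff:
  fixes b :: "int \<Rightarrow> real"
  assumes "finite T" and b: "\<And>n. 0 \<le> b n" and "0 < p"
  shows "expectation (\<lambda>\<omega>. \<bar>\<Sum>n\<in>T. b n * (\<xi> n \<omega> - \<sigma>)\<bar> powr p)
    \<le> 2 * 2 powr (- (p / 2)) * Gamma (p / 2 + 1) * (\<Sum>n\<in>T. (b n)\<^sup>2) powr (p / 2)"
proof (cases "(\<Sum>n\<in>T. (b n)\<^sup>2) = 0")
  \<comment> \<open>The moment bound is optimised by dividing by the sum of squares, so vanishing
    coefficients are treated apart.\<close>
  case True
  then have "b n = 0" if "n \<in> T" for n
    using assms that by (simp add: sum_nonneg_eq_0_iff)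
  then have "(\<Sum>n\<in>T. b n * (\<xi> n \<omega> - \<sigma>)) = 0" for \<omega> by simp
  then show ?thesis using True by simp
next
  case False
  show ?thesis
  proof (rule abs_moment_le_of_exp_moment)
    show "0 < (\<Sum>n\<in>T. (b n)\<^sup>2)" using False by (simp add: sum_nonneg order_less_le)
    show "\<bar>\<Sum>n\<in>T. b n * (\<xi> n \<omega> - \<sigma>)\<bar> \<le> (\<Sum>n\<in>T. b n * 1)" for \<omega>
    proof (rule order_trans[OF sum_abs sum_mono])
      fix n
      have "\<bar>\<xi> n \<omega> - \<sigma>\<bar> \<le> 1" using \<xi>_cases[of n \<omega>] \<sigma>_nonneg \<sigma>_le_1 by auto
      then show "\<bar>b n * (\<xi> n \<omega> - \<sigma>)\<bar> \<le> b n * 1"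
        using b[of n] unfolding abs_mult by (intro mult_mono) auto
    qed
    show "expectation (\<lambda>\<omega>. exp (l * (\<Sum>n\<in>T. b n * (\<xi> n \<omega> - \<sigma>)))) \<le> exp (l\<^sup>2 * (\<Sum>n\<in>T. (b n)\<^sup>2) / 8)" for l
    proof (cases "0 \<le> l")
      case True
      have "expectation (\<lambda>\<omega>. exp (\<Sum>n\<in>T. (l * b n) * (\<xi> n \<omega> - \<sigma>))) \<le> exp ((\<Sum>n\<in>T. (l * b n)\<^sup>2) / 8)"
      proof (rule exp_moment_le)
        show "expectation (\<lambda>\<omega>. \<Prod>n\<in>S. \<xi> n \<omega>) \<le> \<sigma> ^ card S" if "S \<subseteq> T" for S
          by (rule correlation_le[OF finite_subset[OF that \<open>finite T\<close>]])
        show "0 \<le> l * b n" for n using True b by simp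
      qed (rule \<open>finite T\<close> \<xi>_measurable \<xi>_cases \<sigma>_nonneg)+
      then show ?thesis by (simp add: sum_distrib_left power_mult_distrib mult.assoc)
    next
      case False
      \<comment> \<open>For negative \<open>l\<close> the sign moves into the variable:
        \<open>1 - \<xi> n\<close> has centred value opposite to that of \<open>\<xi> n\<close>, and
        the coefficients \<open>- l * b n\<close> are nonnegative.\<close>
      have "expectation (\<lambda>\<omega>. exp (\<Sum>n\<in>T. (- l * b n) * ((1 - \<xi> n \<omega>) - (1 - \<sigma>))))
          \<le> exp ((\<Sum>n\<in>T. (- l * b n)\<^sup>2) / 8)"
      proof (rule exp_moment_le)
        show "1 - \<xi> n \<omega> \<in> {0, 1}" for n \<omega> using \<xi>_cases[of n \<omega>] by auto
        show "expectation (\<lambda>\<omega>. \<Prod>n\<in>S. 1 - \<xi> n \<omega>) \<le> (1 - \<sigma>) ^ card S" if "S \<subseteq> T" for S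
          by (rule vacancy_le[OF finite_subset[OF that \<open>finite T\<close>]])
        show "0 \<le> - l * b n" for n using False b[of n] by (simp add: mult_nonpos_nonneg)
      qed (simp_all add: \<open>finite T\<close> \<sigma>_le_1)
      also have "(\<lambda>\<omega>. exp (\<Sum>n\<in>T. (- l * b n) * ((1 - \<xi> n \<omega>) - (1 - \<sigma>))))
          = (\<lambda>\<omega>. exp (l * (\<Sum>n\<in>T. b n * (\<xi> n \<omega> - \<sigma>))))"
        by (intro ext arg_cong[of _ _ exp]) (simp add: sum_distrib_left algebra_simps)
      finally show ?thesis by (simp add: sum_distrib_left power_mult_distrib)
    qed
  qed (simp_all add: \<open>0 < p\<close>)
qed

text \<open>The coefficients are split into the positive and negative parts of their real and imaginary
  parts, because the bound on exponential moments requires coefficients of one sign.\<close>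

lemma moment_partial_sum_le:
  assumes "finite T" and "2 \<le> p"
  shows "(\<integral>\<^sup>+\<omega>. ennreal (norm (partial_sum a T \<omega>) powr p) \<partial>M)
    \<le> ennreal ((2 * sqrt 2) powr p * Gamma (p / 2 + 1) * (\<Sum>n\<in>T. (norm (a n))\<^sup>2) powr (p / 2))"
proof -
  define b :: "nat \<Rightarrow> int \<Rightarrow> real" where
    "b = (\<lambda>k n. if k = 0 then max 0 (Re (a n)) else if k = 1 then max 0 (- Re (a n))
      else if k = 2 then max 0 (Im (a n)) else max 0 (- Im (a n)))"
  define Z where "Z = (\<lambda>k \<omega>. \<Sum>n\<in>T. b k n * (\<xi> n \<omega> - \<sigma>))"
  have b_nonneg: "0 \<le> b k n" for k n by (simp add: b_def)
  have less4: "{..<4::nat} = {0, 1, 2, 3}" by auto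
  have re: "Re (a n) = b 0 n - b 1 n" and im: "Im (a n) = b 2 n - b 3 n" for n
    by (auto simp: b_def max_def)
  have sq: "(norm (a n))\<^sup>2 = (\<Sum>k<4. (b k n)\<^sup>2)" for n
    unfolding cmod_power2 less4 by (auto simp: b_def max_def)
  have Z_meas [measurable]: "Z k \<in> borel_measurable M" for k
    unfolding Z_def by measurable
  have Z_bdd: "\<bar>Z k \<omega>\<bar> \<le> (\<Sum>n\<in>T. b k n * 1)" for k \<omega>
    unfolding Z_def
  proof (rule order_trans[OF sum_abs sum_mono])
    fix n
    have "\<bar>\<xi> n \<omega> - \<sigma>\<bar> \<le> 1" using \<xi>_cases[of n \<omega>] \<sigma>_nonneg \<sigma>_le_1 by auto
    then show "\<bar>b k n * (\<xi> n \<omega> - \<sigma>)\<bar> \<le> b k n * 1"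
      using b_nonneg[of k n] unfolding abs_mult by (intro mult_mono) auto
  qed
  have int: "integrable M (\<lambda>\<omega>. \<bar>Z k \<omega>\<bar> powr p)" for k
    using Z_bdd[of k] \<open>2 \<le> p\<close>
    by (intro integrable_const_bound[of _ "(\<Sum>n\<in>T. b k n * 1) powr p"]) (auto intro!: powr_mono2)
  have le: "norm (partial_sum a T \<omega>) powr p \<le> 4 powr (p - 1) * (\<Sum>k<4. \<bar>Z k \<omega>\<bar> powr p)" for \<omega>
  proof -
    have "Re (partial_sum a T \<omega>) = Z 0 \<omega> - Z 1 \<omega>" "Im (partial_sum a T \<omega>) = Z 2 \<omega> - Z 3 \<omega>"
      by (simp_all add: partial_sum_def Z_def re im sum_subtractf left_diff_distrib)
    then have "norm (partial_sum a T \<omega>) \<le> (\<Sum>k<4. \<bar>Z k \<omega>\<bar>)"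
      using cmod_le[of "partial_sum a T \<omega>"] unfolding less4 by simp
    then have "norm (partial_sum a T \<omega>) powr p \<le> (\<Sum>k<4. \<bar>Z k \<omega>\<bar>) powr p"
      using \<open>2 \<le> p\<close> by (intro powr_mono2) auto
    \<comment> \<open>A power mean of four summands, one for each part.\<close>
    also have "\<dots> \<le> 4 powr (p - 1) * (\<Sum>k<4. \<bar>Z k \<omega>\<bar> powr p)"
      using powr_sum_le[of "{..<4::nat}" "\<lambda>k. \<bar>Z k \<omega>\<bar>" p] \<open>2 \<le> p\<close> by (simp add: lessThan_empty_iff)
    finally show ?thesis .
  qed
  define G where "G = 2 * 2 powr (- (p / 2)) * Gamma (p / 2 + 1)"
  have G: "0 \<le> G" using \<open>2 \<le> p\<close> by (auto simp: G_def intro!: mult_nonneg_nonneg Gamma_real_nonneg)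
  have "(\<integral>\<^sup>+\<omega>. ennreal (norm (partial_sum a T \<omega>) powr p) \<partial>M)
      \<le> (\<integral>\<^sup>+\<omega>. ennreal (4 powr (p - 1) * (\<Sum>k<4. \<bar>Z k \<omega>\<bar> powr p)) \<partial>M)"
    using le by (intro nn_integral_mono ennreal_leI)
  also have "\<dots> = ennreal (expectation (\<lambda>\<omega>. 4 powr (p - 1) * (\<Sum>k<4. \<bar>Z k \<omega>\<bar> powr p)))"
    using int by (intro nn_integral_eq_integral) (auto intro!: mult_nonneg_nonneg sum_nonneg)
  also have "expectation (\<lambda>\<omega>. 4 powr (p - 1) * (\<Sum>k<4. \<bar>Z k \<omega>\<bar> powr p))
      = 4 powr (p - 1) * (\<Sum>k<4. expectation (\<lambda>\<omega>. \<bar>Z k \<omega>\<bar> powr p))"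
    using int by simp
  also have "\<dots> \<le> 4 powr (p - 1) * (\<Sum>k<4. G * (\<Sum>n\<in>T. (b k n)\<^sup>2) powr (p / 2))"
    unfolding Z_def G_def using assms b_nonneg
    by (intro mult_left_mono sum_mono abs_moment_le_nonneg_coeff) auto
  \<comment> \<open>Since \<open>p / 2 \<ge> 1\<close>, the four powers merge into one; the squares
    of the four parts add up to the squared modulus, so the full norm of \<open>a\<close> reappears
    without a further factor.\<close>
  also have "\<dots> \<le> 4 powr (p - 1) * (G * (\<Sum>k<4. \<Sum>n\<in>T. (b k n)\<^sup>2) powr (p / 2))"
    unfolding sum_distrib_left[symmetric] using G \<open>2 \<le> p\<close>
    by (intro mult_left_mono sum_powr_le) (auto intro: sum_nonneg)
  also have "(\<Sum>k<4. \<Sum>n\<in>T. (b k n)\<^sup>2) = (\<Sum>n\<in>T. (norm (a n))\<^sup>2)"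
    unfolding sq by (rule sum.swap)
  also have "4 powr (p - 1) * (G * (\<Sum>n\<in>T. (norm (a n))\<^sup>2) powr (p / 2))
      = 4 powr (p - 1) * 2 * 2 powr (- (p / 2)) * (Gamma (p / 2 + 1) * (\<Sum>n\<in>T. (norm (a n))\<^sup>2) powr (p / 2))"
    by (simp add: G_def)
  also have "\<dots> \<le> (2 * sqrt 2) powr p * (Gamma (p / 2 + 1) * (\<Sum>n\<in>T. (norm (a n))\<^sup>2) powr (p / 2))"
  proof (rule mult_right_mono)
    \<comment> \<open>The exponents of 2 add up to
      \<open>2 * (p - 1) + 1 - p / 2 = 3 / 2 * p - 1\<close>. Dropping the \<open>- 1\<close> makes
      the \<open>p\<close>-th root equal to \<open>2 * sqrt 2\<close> for every
      \<open>p\<close>.\<close>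
    have "4 powr (p - 1) * 2 * 2 powr (- (p / 2)) = 2 powr (2 * (p - 1)) * 2 powr 1 * 2 powr (- (p / 2))"
      using powr_powr[of 2 2 "p - 1"] by simp
    also have "\<dots> = 2 powr (3 / 2 * p - 1)"
      unfolding powr_add[symmetric] by (rule arg_cong[of _ _ "(powr) 2"]) simp
    also have "\<dots> \<le> 2 powr (3 / 2 * p)"
      by (rule powr_mono) auto
    also have "\<dots> = (2 powr (3 / 2)) powr p" by (simp add: powr_powr)
    also have "2 powr (3 / 2) = 2 powr 1 * 2 powr (1 / 2 :: real)"
      unfolding powr_add[symmetric] by simp
    also have "\<dots> = 2 * sqrt 2" by (simp add: powr_half_sqrt)
    finally show "4 powr (p - 1) * 2 * 2 powr (- (p / 2)) \<le> (2 * sqrt 2) powr p" .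
    show "0 \<le> Gamma (p / 2 + 1) * (\<Sum>n\<in>T. (norm (a n))\<^sup>2) powr (p / 2)"
      using \<open>2 \<le> p\<close> by (auto intro!: mult_nonneg_nonneg Gamma_real_nonneg)
  qed
  finally show ?thesis by (simp add: mult.assoc ennreal_leI)
qed

end

section \<open>Infinite sums\<close>

lemma norm_powr_2: "norm (x :: 'b :: real_normed_vector) powr 2 = (norm x)\<^sup>2"
  by (cases "x = 0") simp_all

lemma Lp_norm_le:
  assumes "(\<integral>\<^sup>+\<omega>. ennreal (norm (g \<omega>) powr p) \<partial>M) \<le> ennreal r" "0 \<le> r" "0 < p"
  shows "Lp_norm M p g \<le> ennreal (r powr (1 / p))"
proof -
  have "(\<integral>\<^sup>+\<omega>. ennreal (norm (g \<omega>) powr p) \<partial>M) \<noteq> \<infinity>"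
    using assms(1) ennreal_less_top[of r] by (metis infinity_ennreal_def leD)
  moreover have "enn2real (\<integral>\<^sup>+\<omega>. ennreal (norm (g \<omega>) powr p) \<partial>M) \<le> r"
    using assms by (simp add: enn2real_leI)
  ultimately show ?thesis
    using assms by (auto simp: Lp_norm_def Let_def intro!: ennreal_leI powr_mono2)
qed

lemma Lp_norm_eq:
  assumes "(\<integral>\<^sup>+\<omega>. ennreal (norm (g \<omega>) powr p) \<partial>M) = ennreal r" "0 \<le> r"
  shows "Lp_norm M p g = ennreal (r powr (1 / p))"
  using assms by (simp add: Lp_norm_def)

text \<open>Valid also for infinite values, so limits of norms transfer to second moments without a
  finiteness check.\<close>

lemma Lp_norm_2_squared:
  "Lp_norm M 2 g * Lp_norm M 2 g = (\<integral>\<^sup>+\<omega>. ennreal (norm (g \<omega>) powr 2) \<partial>M)"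
proof (cases "(\<integral>\<^sup>+\<omega>. ennreal (norm (g \<omega>) powr 2) \<partial>M)")
  case (real r)
  then show ?thesis
    by (simp add: Lp_norm_eq[OF real(2,1)] flip: ennreal_mult powr_add)
next
  case top
  then show ?thesis by (simp add: Lp_norm_def ennreal_top_mult)
qed

text \<open>Fatou's lemma along an almost everywhere convergent sequence. The bounds may vary with
  \<open>k\<close>, as they do when the infinite sum is constructed.\<close>

lemma nn_integral_powr_AE_lim_le:
  fixes u :: "nat \<Rightarrow> 'a \<Rightarrow> complex"
  assumes [measurable]: "\<And>k. u k \<in> borel_measurable M"
    and lim: "AE \<omega> in M. (\<lambda>k. u k \<omega>) \<longlonglongrightarrow> v \<omega>"
    and le: "\<And>k. (\<integral>\<^sup>+\<omega>. ennreal (norm (u k \<omega>) powr p) \<partial>M) \<le> c k" and "c \<longlonglongrightarrow> d" and "0 < p"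
  shows "(\<integral>\<^sup>+\<omega>. ennreal (norm (v \<omega>) powr p) \<partial>M) \<le> d"
proof -
  have "(\<integral>\<^sup>+\<omega>. ennreal (norm (v \<omega>) powr p) \<partial>M) = (\<integral>\<^sup>+\<omega>. liminf (\<lambda>k. ennreal (norm (u k \<omega>) powr p)) \<partial>M)"
  proof (rule nn_integral_cong_AE, use lim in eventually_elim)
    fix \<omega> assume "(\<lambda>k. u k \<omega>) \<longlonglongrightarrow> v \<omega>"
    then have "(\<lambda>k. ennreal (norm (u k \<omega>) powr p)) \<longlonglongrightarrow> ennreal (norm (v \<omega>) powr p)"
      using \<open>0 < p\<close> by (intro tendsto_ennrealI tendsto_powr' tendsto_norm tendsto_const) auto
    then show "ennreal (norm (v \<omega>) powr p) = liminf (\<lambda>k. ennreal (norm (u k \<omega>) powr p))"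
      by (rule lim_imp_Liminf[OF trivial_limit_sequentially, symmetric])
  qed
  also have "\<dots> \<le> liminf (\<lambda>k. \<integral>\<^sup>+\<omega>. ennreal (norm (u k \<omega>) powr p) \<partial>M)"
    by (rule nn_integral_liminf) measurable
  also have "\<dots> \<le> liminf c"
    using le by (intro Liminf_mono) simp
  also have "\<dots> = d"
    using \<open>c \<longlonglongrightarrow> d\<close> by (intro lim_imp_Liminf) auto
  finally show ?thesis .
qed

text \<open>Jensen's inequality for the power \<open>p / 2\<close>: for \<open>s > 0\<close> the
  tangent inequality is integrated at the normalised variable
  \<open>(norm (g \<omega>))\<^sup>2 / s\<close>, which has mean 1.\<close>

lemma (in prob_space) Lp_norm_2_le:
  fixes g :: "'a \<Rightarrow> complex"
  assumes [measurable]: "g \<in> borel_measurable M" and "Lp_norm M 2 g < \<infinity>" "2 \<le> p"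
  shows "Lp_norm M 2 g \<le> Lp_norm M p g"
proof (cases "(\<integral>\<^sup>+\<omega>. ennreal (norm (g \<omega>) powr p) \<partial>M)")
  case top
  then show ?thesis by (simp add: Lp_norm_def)
next
  case (real t)
  have "(\<integral>\<^sup>+\<omega>. ennreal (norm (g \<omega>) powr 2) \<partial>M) < \<infinity>"
    unfolding Lp_norm_2_squared[symmetric] using assms(2) by (simp add: ennreal_mult_less_top)
  then obtain s where s: "0 \<le> s" "(\<integral>\<^sup>+\<omega>. ennreal (norm (g \<omega>) powr 2) \<partial>M) = ennreal s"
    by (cases "\<integral>\<^sup>+\<omega>. ennreal (norm (g \<omega>) powr 2) \<partial>M") auto
  have int_s: "has_bochner_integral M (\<lambda>\<omega>. norm (g \<omega>) powr 2) s"
    and int_t: "has_bochner_integral M (\<lambda>\<omega>. norm (g \<omega>) powr p) t"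
    using s real by (auto intro!: has_bochner_integral_nn_integral)
  have "s powr (p / 2) \<le> t"
  proof (cases "s = 0")
    case False
    then have "s > 0" using s by simp
    have const: "has_bochner_integral M (\<lambda>_. 1) (1 :: real)"
      by (simp add: has_bochner_integral_iff prob_space)
    have "has_bochner_integral M (\<lambda>\<omega>. norm (g \<omega>) powr p * (1 / s powr (p / 2))
        - (p / 2 * (norm (g \<omega>) powr 2 * (1 / s) - 1) + 1)) (t * (1 / s powr (p / 2)) - (p / 2 * (s * (1 / s) - 1) + 1))"
      by (intro has_bochner_integral_diff has_bochner_integral_add has_bochner_integral_mult_left
          has_bochner_integral_mult_right int_s int_t const)
    then have "0 \<le> t * (1 / s powr (p / 2)) - (p / 2 * (s * (1 / s) - 1) + 1)"
    proof (rule has_bochner_integral_imp_nonneg)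
      fix \<omega>
      have "1 + p / 2 * ((norm (g \<omega>))\<^sup>2 / s - 1) \<le> ((norm (g \<omega>))\<^sup>2 / s) powr (p / 2)"
        using \<open>2 \<le> p\<close> \<open>s > 0\<close> by (intro powr_ge_tangent) auto
      also have "\<dots> = norm (g \<omega>) powr p / s powr (p / 2)"
      proof -
        have "((norm (g \<omega>))\<^sup>2) powr (p / 2) = norm (g \<omega>) powr p"
          unfolding norm_powr_2[symmetric] powr_powr by simp
        then show ?thesis using \<open>s > 0\<close> by (simp add: powr_divide)
      qed
      finally show "0 \<le> norm (g \<omega>) powr p * (1 / s powr (p / 2))
          - (p / 2 * (norm (g \<omega>) powr 2 * (1 / s) - 1) + 1)"
        by (simp add: norm_powr_2)
    qed
    then show ?thesis using \<open>s > 0\<close> by (simp add: field_simps)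
  qed (use real in simp)
  then have "(s powr (p / 2)) powr (1 / p) \<le> t powr (1 / p)"
    using \<open>2 \<le> p\<close> by (intro powr_mono2) auto
  then show ?thesis
    using \<open>2 \<le> p\<close> by (simp add: Lp_norm_eq[OF s(2,1)] Lp_norm_eq[OF real(2,1)] powr_powr)
qed

text \<open>Almost everywhere limits call for a sequence in place of the net of finite sets; the
  sets chosen need not increase.\<close>

lemma summable_on_finite_subset_seq:
  fixes g :: "'i \<Rightarrow> real" and \<epsilon> :: "nat \<Rightarrow> real"
  assumes "g summable_on UNIV" "\<And>k. 0 < \<epsilon> k"
  obtains G where "\<And>k. finite (G k)" "\<And>k. infsum g UNIV - sum g (G k) < \<epsilon> k"
proof -
  have "\<exists>G. finite G \<and> infsum g UNIV - sum g G < \<epsilon> k" for k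
  proof -
    have "\<forall>\<^sub>F F in finite_subsets_at_top UNIV. infsum g UNIV - \<epsilon> k < sum g F"
      using infsum_tendsto[OF assms(1)] assms(2)[of k] by (intro order_tendstoD(1)) auto
    then show ?thesis
      unfolding eventually_finite_subsets_at_top by (auto simp: algebra_simps)
  qed
  then show ?thesis using that by metis
qed

section \<open>Existence and moments of the infinite sum\<close>

context stationary_dpp
begin

text \<open>The difference is itself a finite sum, with coefficients on the symmetric difference of
  \<open>F\<close> and \<open>G\<close>; each half of that set lies in a tail. The moment bound at
  \<open>p = 2\<close> thus becomes a Cauchy criterion.\<close>

lemma partial_sum_diff_le:
  fixes a :: "int \<Rightarrow> complex"
  defines "g \<equiv> \<lambda>n. (norm (a n))\<^sup>2"
  assumes "g summable_on UNIV" "finite F" "finite G"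
  shows "(\<integral>\<^sup>+\<omega>. ennreal (norm (partial_sum a G \<omega> - partial_sum a F \<omega>) powr 2) \<partial>M)
    \<le> ennreal (8 * ((infsum g UNIV - sum g F) + (infsum g UNIV - sum g G)))"
proof -
  have g: "0 \<le> g n" for n by (simp add: g_def)
  define U where "U = F \<union> G"
  have U: "finite U" using assms by (simp add: U_def)
  define b where "b = (\<lambda>n. of_bool (n \<in> G) * a n - of_bool (n \<in> F) * a n)"
  have extend: "partial_sum a H \<omega> = (\<Sum>n\<in>U. of_bool (n \<in> H) * a n * of_real (\<xi> n \<omega> - \<sigma>))" if "H \<subseteq> U" for H \<omega>
    unfolding partial_sum_def using that U by (intro sum.mono_neutral_cong_left) auto
  have b: "partial_sum b U \<omega> = partial_sum a G \<omega> - partial_sum a F \<omega>" for \<omega>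
  proof -
    have "G \<subseteq> U" "F \<subseteq> U" by (auto simp: U_def)
    then show ?thesis
      by (simp only: extend) (simp only: partial_sum_def b_def left_diff_distrib sum_subtractf)
  qed
  have "(\<Sum>n\<in>U. (norm (b n))\<^sup>2) = (\<Sum>n\<in>U. of_bool (n \<in> G - F) * g n) + (\<Sum>n\<in>U. of_bool (n \<in> F - G) * g n)"
    unfolding sum.distrib[symmetric] by (intro sum.cong refl) (auto simp: b_def g_def)
  also have "(\<Sum>n\<in>U. of_bool (n \<in> G - F) * g n) = sum g (G - F)"
    using U by (intro sum.mono_neutral_cong_right) (auto simp: U_def)
  also have "(\<Sum>n\<in>U. of_bool (n \<in> F - G) * g n) = sum g (F - G)"
    using U by (intro sum.mono_neutral_cong_right) (auto simp: U_def)
  also have "sum g (G - F) + sum g (F - G) \<le> (infsum g UNIV - sum g F) + (infsum g UNIV - sum g G)"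
  proof -
    have *: "sum g H + sum g (H' - H) \<le> infsum g UNIV" if "finite H" "finite H'" for H H'
    proof -
      have "sum g H + sum g (H' - H) = sum g (H \<union> (H' - H))"
        using that by (intro sum.union_disjoint[symmetric]) auto
      also have "\<dots> \<le> infsum g UNIV"
        using that assms(2) g by (intro finite_sum_le_infsum) auto
      finally show ?thesis .
    qed
    show ?thesis using *[of F G] *[of G F] assms by simp
  qed
  finally have le: "(\<Sum>n\<in>U. (norm (b n))\<^sup>2) \<le> (infsum g UNIV - sum g F) + (infsum g UNIV - sum g G)" .
  \<comment> \<open>The upper constant at \<open>p = 2\<close> is
    \<open>8 * Gamma 2 = 8\<close>.\<close>
  have "(2 * sqrt 2) powr 2 = (8 :: real)"
    by (simp add: power_mult_distrib)
  moreover have "Gamma (2 / 2 + 1 :: real) = 1"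
    using Gamma_fact[of 1, where ?'a = real] by simp
  ultimately have "(\<integral>\<^sup>+\<omega>. ennreal (norm (partial_sum b U \<omega>) powr 2) \<partial>M)
      \<le> ennreal (8 * (\<Sum>n\<in>U. (norm (b n))\<^sup>2))"
    using moment_partial_sum_le[OF U, of 2 b] by (simp add: sum_nonneg)
  also have "\<dots> \<le> ennreal (8 * ((infsum g UNIV - sum g F) + (infsum g UNIV - sum g G)))"
    using le by (intro ennreal_leI) simp
  finally show ?thesis unfolding b .
qed

text \<open>A Riesz-Fischer argument: finite sets with geometrically small tails give an almost sure
  limit. Fatou then estimates its distance to every finite partial sum, so convergence holds along
  all finite sets and not only along the chosen sequence.\<close>

lemma L2_sum_exists:
  fixes a :: "int \<Rightarrow> complex"
  assumes summable: "(\<lambda>n. (norm (a n))\<^sup>2) summable_on UNIV"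
  shows "\<exists>S. has_L2_sum M (\<lambda>n \<omega>. a n * of_real (\<xi> n \<omega> - \<sigma>)) S"
proof -
  define g where "g = (\<lambda>n. (norm (a n))\<^sup>2)"
  define A where "A = infsum g UNIV"
  have g: "g summable_on UNIV" using summable by (simp add: g_def)
  obtain G where fin: "\<And>k. finite (G k)" and G: "\<And>k. A - sum g (G k) < (1 / 4) ^ k"
    unfolding A_def by (rule summable_on_finite_subset_seq[OF g, of "\<lambda>k. (1 / 4) ^ k"]) auto
  have diff: "(\<integral>\<^sup>+\<omega>. ennreal (norm (partial_sum a H \<omega> - partial_sum a F \<omega>) powr 2) \<partial>M)
      \<le> ennreal (8 * ((A - sum g F) + (A - sum g H)))" if "finite F" "finite H" for F H
    unfolding A_def g_def by (rule partial_sum_diff_le[OF summable that])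
  have sum_le: "sum g F \<le> A" if "finite F" for F
    unfolding A_def using that g by (intro finite_sum_le_infsum) (auto simp: g_def)
  define D where "D = (\<lambda>k \<omega>. partial_sum a (G (Suc k)) \<omega> - partial_sum a (G k) \<omega>)"
  have D_meas [measurable]: "D k \<in> borel_measurable M" for k unfolding D_def by measurable
  have D_le: "(\<integral>\<^sup>+\<omega>. ennreal (norm (D k \<omega>)) \<partial>M) \<le> ennreal (17 * (1 / 2) ^ k)" for k
  proof -
    have "(\<integral>\<^sup>+\<omega>. ennreal (norm (D k \<omega>)) \<partial>M)
        \<le> (\<integral>\<^sup>+\<omega>. ennreal (2 ^ k) * ennreal (norm (D k \<omega>) powr 2) + ennreal ((1 / 2) ^ k) \<partial>M)"
    proof (rule nn_integral_mono)
      fix \<omega>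
      define x where "x = norm (D k \<omega>)"
      \<comment> \<open>A weighted inequality passes from second to first moments. Because the tails
        decay like \<open>(1 / 4) ^ k\<close>, the weight \<open>2 ^ k\<close> leaves both terms of
        order \<open>(1 / 2) ^ k\<close>, which is summable.\<close>
      have "x \<le> 2 ^ k * x\<^sup>2 + (1 / 2) ^ k"
      proof -
        have "0 \<le> (2 ^ k * x - 1)\<^sup>2 + 2 ^ k * x" by (simp add: x_def)
        then have "2 ^ k * x \<le> 2 ^ k * (2 ^ k * x\<^sup>2) + 1"
          by (simp add: power2_eq_square algebra_simps)
        then show ?thesis by (simp add: power_one_over field_simps)
      qed
      then show "ennreal (norm (D k \<omega>)) \<le> ennreal (2 ^ k) * ennreal (norm (D k \<omega>) powr 2) + ennreal ((1 / 2) ^ k)"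
        by (simp add: x_def flip: ennreal_mult ennreal_plus)
    qed
    also have "\<dots> = ennreal (2 ^ k) * (\<integral>\<^sup>+\<omega>. ennreal (norm (D k \<omega>) powr 2) \<partial>M) + ennreal ((1 / 2) ^ k)"
      by (simp add: nn_integral_add nn_integral_cmult emeasure_space_1)
    also have "\<dots> \<le> ennreal (2 ^ k) * ennreal (16 * (1 / 4) ^ k) + ennreal ((1 / 2) ^ k)"
    proof (intro add_mono mult_left_mono order_refl)
      have "8 * ((A - sum g (G k)) + (A - sum g (G (Suc k)))) \<le> 16 * (1 / 4) ^ k"
      proof -
        define x where "x = (1 / 4 :: real) ^ k"
        have "0 \<le> x" "A - sum g (G k) < x" "A - sum g (G (Suc k)) < x / 4"
          using G[of k] G[of "Suc k"] by (simp_all add: x_def)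
        then show ?thesis unfolding x_def[symmetric] by argo
      qed
      then show "(\<integral>\<^sup>+\<omega>. ennreal (norm (D k \<omega>) powr 2) \<partial>M) \<le> ennreal (16 * (1 / 4) ^ k)"
        unfolding D_def by (rule order_trans[OF diff[OF fin fin] ennreal_leI])
    qed auto
    also have "\<dots> = ennreal (2 ^ k * (16 * (1 / 4) ^ k) + (1 / 2) ^ k)"
      by (simp flip: ennreal_mult)
    also have "2 ^ k * (16 * (1 / 4) ^ k) + (1 / 2) ^ k = 17 * (1 / 2 :: real) ^ k"
    proof -
      have "2 ^ k * (1 / 4) ^ k = (1 / 2 :: real) ^ k"
        by (simp flip: power_mult_distrib)
      then show ?thesis by simp
    qed
    finally show ?thesis .
  qed
  have "(\<integral>\<^sup>+\<omega>. (\<Sum>k. ennreal (norm (D k \<omega>))) \<partial>M) = (\<Sum>k. \<integral>\<^sup>+\<omega>. ennreal (norm (D k \<omega>)) \<partial>M)"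
    by (rule nn_integral_suminf) measurable
  also have "\<dots> \<le> (\<Sum>k. ennreal (17 * (1 / 2) ^ k))"
    by (intro suminf_le D_le) auto
  also have "\<dots> < \<infinity>"
    unfolding infinity_ennreal_def less_top[symmetric]
    by (intro ennreal_suminf_neq_top summable_mult summable_geometric) auto
  finally have "(\<integral>\<^sup>+\<omega>. (\<Sum>k. ennreal (norm (D k \<omega>))) \<partial>M) \<noteq> \<infinity>"
    by (rule less_imp_neq)
  then have "AE \<omega> in M. (\<Sum>k. ennreal (norm (D k \<omega>))) \<noteq> \<infinity>"
    by (intro nn_integral_PInf_AE) measurable
  then have lim: "AE \<omega> in M. (\<lambda>k. partial_sum a (G k) \<omega>) \<longlonglongrightarrow> lim (\<lambda>k. partial_sum a (G k) \<omega>)"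
  proof eventually_elim
    case (elim \<omega>)
    then have "summable (\<lambda>k. norm (D k \<omega>))"
      using summable_iff_suminf_neq_top[of "\<lambda>k. norm (D k \<omega>)"] by auto
    then have "summable (\<lambda>k. D k \<omega>)" by (rule summable_norm_cancel)
    then have "(\<lambda>n. (\<Sum>k<n. D k \<omega>) + partial_sum a (G 0) \<omega>) \<longlonglongrightarrow> (\<Sum>k. D k \<omega>) + partial_sum a (G 0) \<omega>"
      by (intro tendsto_add summable_LIMSEQ tendsto_const)
    then have "(\<lambda>n. partial_sum a (G n) \<omega>) \<longlonglongrightarrow> (\<Sum>k. D k \<omega>) + partial_sum a (G 0) \<omega>"
      by (simp add: D_def sum_lessThan_telescope[of "\<lambda>k. partial_sum a (G k) \<omega>"])
    then have "convergent (\<lambda>k. partial_sum a (G k) \<omega>)" by (rule convergentI)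
    then show ?case by (simp add: convergent_LIMSEQ_iff)
  qed
  \<comment> \<open>\<open>lim\<close> is total; its value where the sequence diverges does not
    matter, since that happens on a null set.\<close>
  define S where "S = (\<lambda>\<omega>. lim (\<lambda>k. partial_sum a (G k) \<omega>))"
  have S_meas [measurable]: "S \<in> borel_measurable M" unfolding S_def by measurable
  have S_le: "(\<integral>\<^sup>+\<omega>. ennreal (norm (S \<omega> - partial_sum a F \<omega>) powr 2) \<partial>M) \<le> ennreal (8 * (A - sum g F))"
    if "finite F" for F
  proof (rule nn_integral_powr_AE_lim_le)
    show "AE \<omega> in M. (\<lambda>k. partial_sum a (G k) \<omega> - partial_sum a F \<omega>) \<longlonglongrightarrow> S \<omega> - partial_sum a F \<omega>"
      using lim unfolding S_def by eventually_elim (intro tendsto_diff tendsto_const)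
    show "(\<integral>\<^sup>+\<omega>. ennreal (norm (partial_sum a (G k) \<omega> - partial_sum a F \<omega>) powr 2) \<partial>M)
        \<le> ennreal (8 * ((A - sum g F) + (1 / 4) ^ k))" for k
      using G[of k] by (intro order_trans[OF diff[OF that fin] ennreal_leI]) simp
    have "(\<lambda>k. 8 * ((A - sum g F) + (1 / 4) ^ k)) \<longlonglongrightarrow> 8 * ((A - sum g F) + 0)"
      by (intro tendsto_intros LIMSEQ_power_zero) auto
    then show "(\<lambda>k. ennreal (8 * ((A - sum g F) + (1 / 4) ^ k))) \<longlonglongrightarrow> ennreal (8 * (A - sum g F))"
      by (intro tendsto_ennrealI) simp
  qed auto
  have Lp_le: "Lp_norm M 2 (\<lambda>\<omega>. S \<omega> - partial_sum a F \<omega>) \<le> ennreal ((8 * (A - sum g F)) powr (1 / 2))"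
    if "finite F" for F
    using S_le[OF that] sum_le[OF that] by (intro Lp_norm_le) auto
  have "has_L2_sum M (\<lambda>n \<omega>. a n * of_real (\<xi> n \<omega> - \<sigma>)) S"
    unfolding has_L2_sum_def partial_sum_def[symmetric]
  proof (intro conjI S_meas)
    \<comment> \<open>The empty partial sum is 0, so square integrability of \<open>S\<close> is the
      case \<open>F = {}\<close> of the distance bound.\<close>
    have "Lp_norm M 2 (\<lambda>\<omega>. S \<omega> - partial_sum a {} \<omega>) < \<infinity>"
      using Lp_le[of "{}"] by (rule le_less_trans) auto
    then show "Lp_norm M 2 S < \<infinity>" by (simp add: partial_sum_def)
    have "((\<lambda>F. (8 * (A - sum g F)) powr (1 / 2)) \<longlongrightarrow> (8 * (A - A)) powr (1 / 2)) (finite_subsets_at_top UNIV)"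
    proof (rule tendsto_powr')
      show "((\<lambda>F. 8 * (A - sum g F)) \<longlongrightarrow> 8 * (A - A)) (finite_subsets_at_top UNIV)"
        unfolding A_def by (intro tendsto_intros infsum_tendsto g)
      \<comment> \<open>The base tends to 0, where the continuity rule for \<open>powr\<close> asks
        for a positive exponent and eventually nonnegative bases.\<close>
      show "8 * (A - A) \<noteq> 0 \<or> 0 < (1 / 2 :: real) \<and> (\<forall>\<^sub>F F in finite_subsets_at_top UNIV. 0 \<le> 8 * (A - sum g F))"
        using sum_le by (auto intro: eventually_finite_subsets_at_top_weakI)
    qed auto
    then have "((\<lambda>F. ennreal ((8 * (A - sum g F)) powr (1 / 2))) \<longlongrightarrow> ennreal ((8 * (A - A)) powr (1 / 2)))
        (finite_subsets_at_top UNIV)"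
      by (rule tendsto_ennrealI)
    then have bound: "((\<lambda>F. ennreal ((8 * (A - sum g F)) powr (1 / 2))) \<longlongrightarrow> 0) (finite_subsets_at_top UNIV)"
      by simp
    have "\<forall>\<^sub>F F in finite_subsets_at_top UNIV.
        Lp_norm M 2 (\<lambda>\<omega>. S \<omega> - partial_sum a F \<omega>) \<le> ennreal ((8 * (A - sum g F)) powr (1 / 2))"
      by (rule eventually_finite_subsets_at_top_weakI) (rule Lp_le)
    then show "((\<lambda>F. Lp_norm M 2 (\<lambda>\<omega>. S \<omega> - partial_sum a F \<omega>)) \<longlongrightarrow> 0) (finite_subsets_at_top UNIV)"
      by (intro tendsto_sandwich[OF _ _ tendsto_const bound]) simp_all
  qed
  then show ?thesis by blast
qed

lemma L2_sum_nn_integral_tendsto: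
  assumes "has_L2_sum M (\<lambda>n \<omega>. a n * of_real (\<xi> n \<omega> - \<sigma>)) S"
  shows "((\<lambda>F. \<integral>\<^sup>+\<omega>. ennreal (norm (S \<omega> - partial_sum a F \<omega>) powr 2) \<partial>M) \<longlongrightarrow> 0) (finite_subsets_at_top UNIV)"
proof -
  let ?N = "\<lambda>F. Lp_norm M 2 (\<lambda>\<omega>. S \<omega> - partial_sum a F \<omega>)"
  have "(?N \<longlongrightarrow> 0) (finite_subsets_at_top UNIV)"
    using assms by (simp add: has_L2_sum_def partial_sum_def)
  then have "((\<lambda>F. ?N F * ?N F) \<longlongrightarrow> 0 * 0) (finite_subsets_at_top UNIV)"
    by (intro tendsto_mult_ennreal) auto
  then show ?thesis by (simp only: Lp_norm_2_squared mult_zero_left)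
qed

text \<open>Only convergence in \<open>L^2\<close> is given, while the bound concerns
  \<open>p\<close>-th moments. Almost sure convergence along a sequence of finite sets bridges the
  gap: Fatou preserves the bound, which is uniform over finite sets.\<close>

lemma L2_sum_moment_le:
  fixes a :: "int \<Rightarrow> complex"
  assumes summable: "(\<lambda>n. (norm (a n))\<^sup>2) summable_on UNIV" and "2 \<le> p"
    and S: "has_L2_sum M (\<lambda>n \<omega>. a n * of_real (\<xi> n \<omega> - \<sigma>)) S"
  shows "(\<integral>\<^sup>+\<omega>. ennreal (norm (S \<omega>) powr p) \<partial>M)
    \<le> ennreal ((2 * sqrt 2) powr p * Gamma (p / 2 + 1) * (\<Sum>\<^sub>\<infinity>n. (norm (a n))\<^sup>2) powr (p / 2))"
proof -
  define N where "N = (\<lambda>F. \<integral>\<^sup>+\<omega>. ennreal (norm (S \<omega> - partial_sum a F \<omega>) powr 2) \<partial>M)"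
  have S_meas [measurable]: "S \<in> borel_measurable M" using S by (simp add: has_L2_sum_def)
  have "\<exists>F. finite F \<and> N F < ennreal (1 / Suc k)" for k
  proof -
    have "\<forall>\<^sub>F F in finite_subsets_at_top UNIV. N F < ennreal (1 / Suc k)"
      using L2_sum_nn_integral_tendsto[OF S] unfolding N_def
      by (rule order_tendstoD(2)) (simp add: zero_less_divide_iff)
    then show ?thesis
      unfolding eventually_finite_subsets_at_top by auto
  qed
  then obtain G where fin: "\<And>k. finite (G k)" and G: "\<And>k. N (G k) < ennreal (1 / Suc k)"
    by metis
  define u where "u = (\<lambda>k \<omega>. norm (S \<omega> - partial_sum a (G k) \<omega>) powr 2)"
  have u_meas [measurable]: "u k \<in> borel_measurable M" for k unfolding u_def by measurable
  have u_le: "(\<integral>\<^sup>+\<omega>. ennreal (u k \<omega>) \<partial>M) < ennreal (1 / Suc k)" for k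
    using G[of k] by (simp add: N_def u_def)
  have int: "integrable M (u k)" for k
    using order.strict_trans[OF u_le[of k] ennreal_less_top]
    by (intro integrableI_bounded) (auto simp: u_def)
  have "(\<lambda>k. expectation (\<lambda>\<omega>. norm (u k \<omega>))) \<longlonglongrightarrow> 0"
  proof (rule tendsto_sandwich[OF _ _ tendsto_const])
    show "\<forall>\<^sub>F k in sequentially. expectation (\<lambda>\<omega>. norm (u k \<omega>)) \<le> 1 / Suc k"
    proof (intro always_eventually allI)
      fix k
      have "ennreal (expectation (\<lambda>\<omega>. norm (u k \<omega>))) = (\<integral>\<^sup>+\<omega>. ennreal (u k \<omega>) \<partial>M)"
        using int[of k] by (subst nn_integral_eq_integral) (auto simp: u_def)
      then have "ennreal (expectation (\<lambda>\<omega>. norm (u k \<omega>))) \<le> ennreal (1 / Suc k)"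
        using u_le[of k] by simp
      then show "expectation (\<lambda>\<omega>. norm (u k \<omega>)) \<le> 1 / Suc k"
        by (subst (asm) ennreal_le_iff) auto
    qed
    show "(\<lambda>k. 1 / real (Suc k)) \<longlonglongrightarrow> 0"
      using LIMSEQ_inverse_real_of_nat by (simp add: inverse_eq_divide)
  qed auto
  then obtain r where "AE \<omega> in M. (\<lambda>k. u (r k) \<omega>) \<longlonglongrightarrow> 0"
    using tendsto_L1_AE_subseq[of M u, OF int] by auto
  then have lim: "AE \<omega> in M. (\<lambda>k. partial_sum a (G (r k)) \<omega>) \<longlonglongrightarrow> S \<omega>"
  proof eventually_elim
    case (elim \<omega>)
    then have "(\<lambda>k. sqrt (u (r k) \<omega>)) \<longlonglongrightarrow> sqrt 0" by (rule tendsto_real_sqrt)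
    then have "(\<lambda>k. norm (partial_sum a (G (r k)) \<omega> - S \<omega>)) \<longlonglongrightarrow> 0"
      by (simp add: u_def norm_powr_2 norm_minus_commute)
    then show ?case by (rule LIM_zero_cancel[OF tendsto_norm_zero_cancel])
  qed
  show ?thesis
  proof (rule nn_integral_powr_AE_lim_le[OF _ lim _ tendsto_const])
    fix k
    have "(\<Sum>n\<in>G (r k). (norm (a n))\<^sup>2) \<le> (\<Sum>\<^sub>\<infinity>n. (norm (a n))\<^sup>2)"
      by (rule finite_sum_le_infsum[OF summable fin]) auto
    then have "(\<Sum>n\<in>G (r k). (norm (a n))\<^sup>2) powr (p / 2) \<le> (\<Sum>\<^sub>\<infinity>n. (norm (a n))\<^sup>2) powr (p / 2)"
      using \<open>2 \<le> p\<close> by (intro powr_mono2) (auto intro: sum_nonneg)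
    then show "(\<integral>\<^sup>+\<omega>. ennreal (norm (partial_sum a (G (r k)) \<omega>) powr p) \<partial>M)
      \<le> ennreal ((2 * sqrt 2) powr p * Gamma (p / 2 + 1) * (\<Sum>\<^sub>\<infinity>n. (norm (a n))\<^sup>2) powr (p / 2))"
      using \<open>2 \<le> p\<close>
      by (intro order_trans[OF moment_partial_sum_le[OF fin \<open>2 \<le> p\<close>] ennreal_leI] mult_left_mono)
        (auto intro!: mult_nonneg_nonneg Gamma_real_nonneg)
  qed (use \<open>2 \<le> p\<close> in auto)
qed

lemma L2_sum_second_moment_ge:
  fixes a :: "int \<Rightarrow> complex"
  assumes summable: "(\<lambda>n. (norm (a n))\<^sup>2) summable_on UNIV"
    and S: "has_L2_sum M (\<lambda>n \<omega>. a n * of_real (\<xi> n \<omega> - \<sigma>)) S"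
    and s: "(\<integral>\<^sup>+\<omega>. ennreal (norm (S \<omega>) powr 2) \<partial>M) = ennreal s" "0 \<le> s"
  shows "(\<integral>t. f t * (1 - f t) \<partial>torus) * (\<Sum>\<^sub>\<infinity>n. (norm (a n))\<^sup>2) \<le> s"
proof (rule field_le_epsilon)
  fix e :: real assume "e > 0"
  \<comment> \<open>Chosen so that \<open>\<epsilon> * s \<le> e\<close>; the \<open>+ 1\<close>
    keeps the denominator positive when \<open>s = 0\<close>.\<close>
  define \<epsilon> where "\<epsilon> = e / (s + 1)"
  have \<epsilon>: "\<epsilon> > 0" using \<open>e > 0\<close> s by (simp add: \<epsilon>_def)
  define I where "I = (\<integral>t. f t * (1 - f t) \<partial>torus)"
  have S_meas [measurable]: "S \<in> borel_measurable M" using S by (simp add: has_L2_sum_def)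
  define N where "N = (\<lambda>F. \<integral>\<^sup>+\<omega>. ennreal (norm (S \<omega> - partial_sum a F \<omega>) powr 2) \<partial>M)"
  have "((\<lambda>F. ennreal (1 + \<epsilon>) * ennreal s + ennreal (1 + 1 / \<epsilon>) * N F)
      \<longlongrightarrow> ennreal (1 + \<epsilon>) * ennreal s + ennreal (1 + 1 / \<epsilon>) * 0) (finite_subsets_at_top UNIV)"
    using L2_sum_nn_integral_tendsto[OF S] unfolding N_def
    by (intro tendsto_add tendsto_mult_ennreal tendsto_const) auto
  then have 1: "((\<lambda>F. ennreal (1 + \<epsilon>) * ennreal s + ennreal (1 + 1 / \<epsilon>) * N F)
      \<longlongrightarrow> ennreal ((1 + \<epsilon>) * s)) (finite_subsets_at_top UNIV)"
    using \<epsilon> s by (simp add: ennreal_mult)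
  have 2: "((\<lambda>F. ennreal (I * (\<Sum>n\<in>F. (norm (a n))\<^sup>2))) \<longlongrightarrow> ennreal (I * (\<Sum>\<^sub>\<infinity>n. (norm (a n))\<^sup>2)))
      (finite_subsets_at_top UNIV)"
    by (intro tendsto_ennrealI tendsto_mult tendsto_const infsum_tendsto summable)
  have "ennreal (I * (\<Sum>n\<in>F. (norm (a n))\<^sup>2)) \<le> ennreal (1 + \<epsilon>) * ennreal s + ennreal (1 + 1 / \<epsilon>) * N F"
    if "finite F" for F
  proof -
    have "ennreal (I * (\<Sum>n\<in>F. (norm (a n))\<^sup>2)) \<le> ennreal (expectation (\<lambda>\<omega>. (norm (partial_sum a F \<omega>))\<^sup>2))"
      unfolding I_def by (intro ennreal_leI expectation_partial_sum_ge that)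
    \<comment> \<open>The Bochner integral of a non-integrable function is 0, so the inequality
      holds in either case.\<close>
    also have "\<dots> \<le> (\<integral>\<^sup>+\<omega>. ennreal ((norm (partial_sum a F \<omega>))\<^sup>2) \<partial>M)"
      by (cases "integrable M (\<lambda>\<omega>. (norm (partial_sum a F \<omega>))\<^sup>2)")
        (simp_all add: nn_integral_eq_integral not_integrable_integral_eq)
    also have "\<dots> \<le> (\<integral>\<^sup>+\<omega>. ennreal (1 + \<epsilon>) * ennreal (norm (S \<omega>) powr 2) +
        ennreal (1 + 1 / \<epsilon>) * ennreal (norm (S \<omega> - partial_sum a F \<omega>) powr 2) \<partial>M)"
    proof (rule nn_integral_mono)
      fix \<omega>
      define x y where "x = norm (S \<omega>)" and "y = norm (S \<omega> - partial_sum a F \<omega>)"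
      have "norm (partial_sum a F \<omega>) \<le> x + y"
        unfolding x_def y_def using norm_triangle_ineq4[of "S \<omega>" "S \<omega> - partial_sum a F \<omega>"] by simp
      then have "(norm (partial_sum a F \<omega>))\<^sup>2 \<le> (x + y)\<^sup>2"
        by (intro power_mono) auto
      \<comment> \<open>The factor of the \<open>S\<close> term stays close to 1, and the large
        factor \<open>1 + 1 / \<epsilon>\<close> meets a second moment that tends to 0.\<close>
      also have "\<dots> \<le> (1 + \<epsilon>) * x\<^sup>2 + (1 + 1 / \<epsilon>) * y\<^sup>2"
      proof -
        have "0 \<le> (\<epsilon> * x - y)\<^sup>2 / \<epsilon>" using \<epsilon> by simp
        also have "\<dots> = \<epsilon> * x\<^sup>2 + y\<^sup>2 / \<epsilon> - 2 * x * y"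
          using \<epsilon> by (simp add: power2_eq_square field_simps)
        finally show ?thesis by (simp add: power2_eq_square algebra_simps)
      qed
      finally show "ennreal ((norm (partial_sum a F \<omega>))\<^sup>2) \<le> ennreal (1 + \<epsilon>) * ennreal (norm (S \<omega>) powr 2) +
          ennreal (1 + 1 / \<epsilon>) * ennreal (norm (S \<omega> - partial_sum a F \<omega>) powr 2)"
        using \<epsilon> by (simp add: x_def y_def norm_powr_2 ennreal_leI flip: ennreal_mult ennreal_plus)
    qed
    also have "\<dots> = ennreal (1 + \<epsilon>) * ennreal s + ennreal (1 + 1 / \<epsilon>) * N F"
      unfolding N_def s(1)[symmetric] by (subst nn_integral_add) (auto simp: nn_integral_cmult)
    finally show ?thesis .
  qed
  then have "ennreal (I * (\<Sum>\<^sub>\<infinity>n. (norm (a n))\<^sup>2)) \<le> ennreal ((1 + \<epsilon>) * s)"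
    by (intro tendsto_le[OF _ 1 2] eventually_finite_subsets_at_top_weakI) auto
  then have "I * (\<Sum>\<^sub>\<infinity>n. (norm (a n))\<^sup>2) \<le> (1 + \<epsilon>) * s"
    using \<epsilon> s by (subst (asm) ennreal_le_iff) auto
  also have "\<dots> = s + e * (s / (s + 1))" using s by (simp add: \<epsilon>_def field_simps)
  also have "\<dots> \<le> s + e * 1"
    using s \<open>e > 0\<close> by (intro add_left_mono mult_left_mono) auto
  finally show "(\<integral>t. f t * (1 - f t) \<partial>torus) * (\<Sum>\<^sub>\<infinity>n. (norm (a n))\<^sup>2) \<le> s + e"
    by (simp add: I_def)
qed

end

section \<open>Positivity of the variance constant and the final comparison\<close>

lemma integral_f_one_minus_f_pos:
  assumes [measurable]: "f \<in> borel_measurable torus"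
    and f01: "\<And>t. t \<in> space torus \<Longrightarrow> f t \<in> {0..1}" and "\<not> ae_indicator f"
  shows "0 < (\<integral>t. f t * (1 - f t) \<partial>torus)"
proof -
  have nonneg: "0 \<le> f t * (1 - f t)" if "t \<in> space torus" for t
    using f01[OF that] by simp
  have int: "integrable torus (\<lambda>t. f t * (1 - f t))"
  proof (rule torus.integrable_const_bound[of _ 1])
    have "\<bar>f t * (1 - f t)\<bar> \<le> 1" if "t \<in> space torus" for t
      using f01[OF that] unfolding abs_mult by (intro mult_le_one) auto
    then show "AE t in torus. norm (f t * (1 - f t)) \<le> 1" by (intro AE_I2) simp
  qed measurable
  have "(\<integral>t. f t * (1 - f t) \<partial>torus) \<noteq> 0"
  proof
    assume "(\<integral>t. f t * (1 - f t) \<partial>torus) = 0"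
    then have "AE t in torus. f t * (1 - f t) = 0"
      using integral_nonneg_eq_0_iff_AE[OF int AE_I2[OF nonneg]] by simp
    \<comment> \<open>The values are 0 and 1 almost everywhere, so \<open>f\<close> is the indicator
      of its own level set at 1.\<close>
    then have "AE t in torus. f t = indicator {t \<in> space torus. f t = 1} t"
      using AE_space by eventually_elim (auto simp: indicator_def)
    moreover have "{t \<in> space torus. f t = 1} \<in> sets torus" by measurable
    ultimately have "ae_indicator f"
      unfolding ae_indicator_def by (rule bexI)
    with \<open>\<not> ae_indicator f\<close> show False ..
  qed
  moreover have "0 \<le> (\<integral>t. f t * (1 - f t) \<partial>torus)"
    using nonneg by (rule Bochner_Integration.integral_nonneg)
  ultimately show ?thesis by simp
qed

theorem theorem4p2:
  fixes f :: "real \<Rightarrow> real" and \<sigma> p :: real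
    and M :: "'w measure" and X :: "'w \<Rightarrow> int set"
  assumes "f \<in> borel_measurable torus"
    and "\<And>t. t \<in> space torus \<Longrightarrow> f t \<in> {0..1}"
    and "\<sigma> = (\<integral>t. f t \<partial>torus)"
    and "\<sigma> \<in> {0<..<1}"
    and "prob_space M"
    and "determinantal_process M f X"
    and "\<not> ae_indicator f"
    and "p \<ge> 2"
  shows "khinchine_const f p > 0 \<and>
    (\<forall>a :: int \<Rightarrow> complex. (\<lambda>n. (norm (a n))\<^sup>2) summable_on UNIV \<longrightarrow>
      (\<exists>S. has_L2_sum M (\<lambda>n \<omega>. a n * complex_of_real (occupation X n \<omega> - \<sigma>)) S) \<and>
      (\<forall>S. has_L2_sum M (\<lambda>n \<omega>. a n * complex_of_real (occupation X n \<omega> - \<sigma>)) S \<longrightarrow>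
        Lp_norm M 2 S \<le> Lp_norm M p S \<and>
        Lp_norm M p S \<le> ennreal (khinchine_const f p) * Lp_norm M 2 S))"
proof -
  interpret prob_space M by fact
  interpret dpp: stationary_dpp M f X
    by unfold_locales (use assms in auto)
  have \<sigma>: "\<sigma> = dpp.\<sigma>" using assms(3) by (simp add: dpp.\<sigma>_def)
  define I where "I = (\<integral>t. f t * (1 - f t) \<partial>torus)"
  have I: "I > 0" unfolding I_def by (rule integral_f_one_minus_f_pos[OF assms(1,2,7)])
  define \<Gamma> where "\<Gamma> = Gamma (p / 2 + 1)"
  have \<Gamma>: "\<Gamma> > 0" using \<open>p \<ge> 2\<close> by (auto simp: \<Gamma>_def intro!: Gamma_real_pos)
  have const: "khinchine_const f p = 2 * sqrt 2 * \<Gamma> powr (1 / p) / sqrt I"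
    by (simp add: khinchine_const_def I_def \<Gamma>_def)
  have pos: "khinchine_const f p > 0" using I \<Gamma> by (simp add: const)
  have "Lp_norm M 2 S \<le> Lp_norm M p S \<and> Lp_norm M p S \<le> ennreal (khinchine_const f p) * Lp_norm M 2 S"
    if summable: "(\<lambda>n. (norm (a n))\<^sup>2) summable_on UNIV"
      and S: "has_L2_sum M (\<lambda>n \<omega>. a n * complex_of_real (occupation X n \<omega> - dpp.\<sigma>)) S"
    for a :: "int \<Rightarrow> complex" and S
  proof
    have S': "S \<in> borel_measurable M" "Lp_norm M 2 S < \<infinity>"
      using S by (auto simp: has_L2_sum_def)
    then show "Lp_norm M 2 S \<le> Lp_norm M p S"
      using \<open>p \<ge> 2\<close> by (rule Lp_norm_2_le)
    have "(\<integral>\<^sup>+\<omega>. ennreal (norm (S \<omega>) powr 2) \<partial>M) < \<infinity>"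
      unfolding Lp_norm_2_squared[symmetric] using S'(2) by (simp add: ennreal_mult_less_top)
    then obtain s where s: "0 \<le> s" "(\<integral>\<^sup>+\<omega>. ennreal (norm (S \<omega>) powr 2) \<partial>M) = ennreal s"
      by (cases "\<integral>\<^sup>+\<omega>. ennreal (norm (S \<omega>) powr 2) \<partial>M") auto
    define A where "A = (\<Sum>\<^sub>\<infinity>n. (norm (a n))\<^sup>2)"
    have "A \<ge> 0" unfolding A_def by (rule infsum_nonneg) simp
    \<comment> \<open>The lower variance bound exchanges the norm of \<open>a\<close> for that of
      \<open>S\<close>; the square root of \<open>I\<close> thereby enters the denominator of the
      constant.\<close>
    have "I * A \<le> s"
      unfolding I_def A_def by (rule dpp.L2_sum_second_moment_ge[OF summable S s(2,1)])
    then have "A \<le> s / I" using I by (simp add: field_simps)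
    have "Lp_norm M p S \<le> ennreal (((2 * sqrt 2) powr p * \<Gamma> * A powr (p / 2)) powr (1 / p))"
      using dpp.L2_sum_moment_le[OF summable \<open>p \<ge> 2\<close> S] \<Gamma> \<open>p \<ge> 2\<close>
      unfolding A_def \<Gamma>_def by (intro Lp_norm_le) auto
    also have "\<dots> \<le> ennreal (((2 * sqrt 2) powr p * \<Gamma> * (s / I) powr (p / 2)) powr (1 / p))"
      using \<open>A \<le> s / I\<close> \<open>A \<ge> 0\<close> \<Gamma> \<open>p \<ge> 2\<close>
      by (intro ennreal_leI powr_mono2 mult_left_mono) auto
    also have "((2 * sqrt 2) powr p * \<Gamma> * (s / I) powr (p / 2)) powr (1 / p)
        = 2 * sqrt 2 * \<Gamma> powr (1 / p) * (s / I) powr (1 / 2)"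
      using \<Gamma> \<open>p \<ge> 2\<close> s I by (simp add: powr_mult powr_powr)
    also have "\<dots> = khinchine_const f p * s powr (1 / 2)"
      using I s by (simp add: const powr_half_sqrt real_sqrt_divide)
    also have "ennreal \<dots> = ennreal (khinchine_const f p) * Lp_norm M 2 S"
      using pos s by (simp add: Lp_norm_eq[OF s(2,1)] ennreal_mult)
    finally show "Lp_norm M p S \<le> ennreal (khinchine_const f p) * Lp_norm M 2 S" .
  qed
  then show ?thesis
    unfolding \<sigma> using pos dpp.L2_sum_exists by blast
qed

end
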